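(* Let $n,m\ge1$ and $d\ge0$ be integers. For each multi-index $i\in\mathbb N^m$ with $0\le|i|=i_1+\dots+i_m\le d$ let $f_i:(\mathbb C^n,0)\to(\mathbb C^n,0)$ be a germ of holomorphic map with $f_i(z)=O(z^2)$. Let $A\in GL_n(\mathbb C)$ have non-resonant eigenvalues, and for $t\in\mathbb C^m$ let $$f_t(z)=Az+\sum_{i\in\mathbb N^m,\ 0\le|i|\le d}t^if_i(z).$$ Suppose that for every $t\in\mathbb C^m$ there is a formal submanifold through $0$, invariant under $f_t$, with equation $F_t(z)=0$, where $F_t:\mathbb C^n\to\mathbb C^p$ is a formal mapping whose coefficients depend polynomially on $t\in\mathbb C^m$; more precisely, there are constants $C_0,C_1>0$ such that the coefficient in $F_t$ of each monomial in $z$ of valuation (total degree) $l$ is a polynomial in $t$ of degree less than $C_0+C_1l$. Then one of the following two alternatives holds: (1) For all $t\in\mathbb C^m$, $F_t$ converges near $0$ and defines an $f_t$-invariant submanifold. (2) There is a set $E\subset\mathbb C^m$ of $\Gamma$-capacity $0$ such that $F_t$ diverges for every $t\in\mathbb C^m\setminus E$.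
   Context: Non-resonant: the eigenvalues $\lambda_1,\dots,\lambda_n$ of $A$, counted with multiplicity, satisfy $\lambda_j-\lambda_1^{k_1}\cdots\lambda_n^{k_n}\ne0$ for all $1\le j\le n$ and all $k\in\mathbb N^n$ with $k_1+\dots+k_n\ge2$. Formal invariant submanifold with equation $F_t=0$: $F_t$ is a $p$-tuple ($1\le p\le n$) of formal power series in $z\in\mathbb C^n$ with $F_t(0)=0$ and $D_0F_t$ of rank $p$, such that the components of $F_t\circ f_t$ lie in the ideal of $\mathbb C[[z_1,\dots,z_n]]$ generated by the components of $F_t$. "Diverges" means that $F_t$ converges in no neighbourhood of $0$. $\Gamma$-capacity: for $E\subset\mathbb C$, $\mathrm{Cap}(E)$ is the logarithmic capacity, $\mathrm{Cap}(E)=\sup_\mu e^{I(\mu)}$, with $I(\mu)=\iint\log|z-w|\,d\mu(z)d\mu(w)$ and $\mu$ ranging over Borel probability measures with compact support in $E$ (with $\mathrm{Cap}(\emptyset)=0$). For $E\subset\mathbb C^m$, $m\ge2$, let $\Gamma_m^{m-1}(E)$ be the set of $z\in\mathbb C^{m-1}$ such that $\{w\in\mathbb C:(z,w)\in E\}$ has positive capacity, and let $\Gamma_m^1(E)=\Gamma_2^1\circ\Gamma_3^2\circ\cdots\circ\Gamma_m^{m-1}(E)\subset\mathbb C$ (with $\Gamma_1^1(E)=E$ when $m=1$). Then $\Gamma\text{-Cap}(E)=\sup_{U\in U(m,\mathbb C)}\mathrm{Cap}\,\Gamma_m^1(U(E))$, $U$ ranging over unitary transformations of $\mathbb C^m$.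 *)

theory Defs
  imports
    "HOL-Analysis.Analysis"
    "HOL-Probability.Probability_Measure"
    "HOL-Library.Landau_Symbols"
begin

section \<open>Formal power series in several variables\<close>

definition mdeg :: "nat^'n \<Rightarrow> nat" where
  "mdeg k = (\<Sum>j\<in>UNIV. k $ j)"

lemma mdeg_add: "mdeg (k + l) = mdeg k + mdeg l"
  by (simp add: mdeg_def sum.distrib)

lemma finite_mdeg_le: "finite {k :: nat^'n. mdeg k \<le> N}"
proof (rule finite_subset)
  show "{k :: nat^'n. mdeg k \<le> N} \<subseteq> vec_lambda ` (Pi\<^sub>E UNIV (\<lambda>_. {..N}))"
  proof
    fix k :: "nat^'n" assume "k \<in> {k. mdeg k \<le> N}"
    then have le: "mdeg k \<le> N" by simp
    have "k $ j \<le> N" for j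
    proof -
      have "k $ j \<le> mdeg k" unfolding mdeg_def by (rule member_le_sum) auto
      then show ?thesis using le by simp
    qed
    then have "vec_nth k \<in> Pi\<^sub>E UNIV (\<lambda>_. {..N})" by auto
    then show "k \<in> vec_lambda ` (Pi\<^sub>E UNIV (\<lambda>_. {..N}))"
      by (metis image_eqI vec_nth_inverse)
  qed
qed (intro finite_imageI finite_PiE; simp)

definition msplits :: "nat^'n \<Rightarrow> ((nat^'n) \<times> (nat^'n)) set" where
  "msplits k = {(i, j). i + j = k}"

lemma finite_msplits [simp]: "finite (msplits k)"
proof (rule finite_subset)
  show "msplits k \<subseteq> {i. mdeg i \<le> mdeg k} \<times> {j. mdeg j \<le> mdeg k}"
    by (auto simp: msplits_def mdeg_add)
qed (intro finite_cartesian_product finite_mdeg_le)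

typedef 'n mfps = "UNIV :: ((nat^('n::finite)) \<Rightarrow> complex) set"
  morphisms mcoeff Abs_mfps ..

lemma mcoeff_Abs [simp]: "mcoeff (Abs_mfps c) = c"
  by (simp add: Abs_mfps_inverse)

lemma mfps_eqI: "(\<And>k. mcoeff a k = mcoeff b k) \<Longrightarrow> a = b"
  by (metis ext mcoeff_inject)

instantiation mfps :: (finite) comm_ring_1
begin

definition zero_mfps :: "'a mfps" where "zero_mfps = Abs_mfps (\<lambda>_. 0)"
definition one_mfps :: "'a mfps" where "one_mfps = Abs_mfps (\<lambda>k. if k = 0 then 1 else 0)"
definition plus_mfps :: "'a mfps \<Rightarrow> 'a mfps \<Rightarrow> 'a mfps" where
  "plus_mfps a b = Abs_mfps (\<lambda>k. mcoeff a k + mcoeff b k)"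
definition minus_mfps :: "'a mfps \<Rightarrow> 'a mfps \<Rightarrow> 'a mfps" where
  "minus_mfps a b = Abs_mfps (\<lambda>k. mcoeff a k - mcoeff b k)"
definition uminus_mfps :: "'a mfps \<Rightarrow> 'a mfps" where
  "uminus_mfps a = Abs_mfps (\<lambda>k. - mcoeff a k)"
definition times_mfps :: "'a mfps \<Rightarrow> 'a mfps \<Rightarrow> 'a mfps" where
  "times_mfps a b = Abs_mfps (\<lambda>k. \<Sum>(i, j)\<in>msplits k. mcoeff a i * mcoeff b j)"

instance
proof
  fix a b c :: "'a mfps"
  note defs = zero_mfps_def one_mfps_def plus_mfps_def minus_mfps_def uminus_mfps_def times_mfps_def
  show "a * b * c = a * (b * c)"
  proof (rule mfps_eqI)
    fix k
    have "mcoeff (a * b * c) k =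
      (\<Sum>x\<in>msplits k. \<Sum>y\<in>msplits (fst x). mcoeff a (fst y) * mcoeff b (snd y) * mcoeff c (snd x))"
      by (simp add: defs sum_distrib_right case_prod_unfold)
    also have "\<dots> = (\<Sum>(x, y)\<in>(SIGMA x:msplits k. msplits (fst x)).
        mcoeff a (fst y) * mcoeff b (snd y) * mcoeff c (snd x))"
      by (rule sum.Sigma) auto
    also have "\<dots> = (\<Sum>(x, y)\<in>(SIGMA x:msplits k. msplits (snd x)).
        mcoeff a (fst x) * (mcoeff b (fst y) * mcoeff c (snd y)))"
      by (rule sum.reindex_bij_witness
          [where i = "\<lambda>(x, y). ((fst x + fst y, snd y), (fst x, fst y))"
             and j = "\<lambda>(x, y). ((fst y, snd y + snd x), (snd y, snd x))"])
        (auto simp: msplits_def add.assoc)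
    also have "\<dots> = (\<Sum>x\<in>msplits k. \<Sum>y\<in>msplits (snd x).
        mcoeff a (fst x) * (mcoeff b (fst y) * mcoeff c (snd y)))"
      by (rule sum.Sigma [symmetric]) auto
    also have "\<dots> = mcoeff (a * (b * c)) k"
      by (simp add: defs sum_distrib_left case_prod_unfold)
    finally show "mcoeff (a * b * c) k = mcoeff (a * (b * c)) k" .
  qed
  show "a * b = b * a"
  proof (rule mfps_eqI)
    fix k
    show "mcoeff (a * b) k = mcoeff (b * a) k"
      unfolding times_mfps_def mcoeff_Abs
      by (rule sum.reindex_bij_witness [where i = prod.swap and j = prod.swap])
        (auto simp: msplits_def add.commute)
  qed
  show "1 * a = a"
  proof (rule mfps_eqI)
    fix k
    have "mcoeff (1 * a) k = (\<Sum>x\<in>msplits k. if x = (0, k) then mcoeff a k else 0)"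
      unfolding times_mfps_def one_mfps_def mcoeff_Abs
      by (rule sum.cong) (auto simp: msplits_def split: if_splits)
    also have "\<dots> = mcoeff a k"
      by (subst sum.delta [OF finite_msplits]) (simp add: msplits_def)
    finally show "mcoeff (1 * a) k = mcoeff a k" .
  qed
  show "(a + b) * c = a * c + b * c"
    by (rule mfps_eqI) (simp add: defs case_prod_unfold distrib_right sum.distrib)
  show "a + b + c = a + (b + c)" "a + b = b + a" "0 + a = a" "- a + a = 0" "a - b = a + - b"
    by (rule mfps_eqI; simp add: defs)+
  show "(0 :: 'a mfps) \<noteq> 1"
  proof
    assume "(0 :: 'a mfps) = 1"
    then have "mcoeff (0 :: 'a mfps) 0 = mcoeff 1 0" by (rule arg_cong)
    then show False by (simp add: zero_mfps_def one_mfps_def)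
  qed
qed

end

text \<open>
  Substitution \<open>F \<circ> G\<close>. A monomial \<open>w\<^sup>l\<close> with \<open>mdeg l > mdeg k\<close> contributes nothing to the
  coefficient of \<open>z\<^sup>k\<close> when the \<open>G j\<close> have no constant term, which is the only case in which
  this operation is used; hence the finite sum.
\<close>
definition mfps_compose :: "'p::finite mfps \<Rightarrow> ('p \<Rightarrow> 'n::finite mfps) \<Rightarrow> 'n mfps" where
  "mfps_compose F G =
     Abs_mfps (\<lambda>k. \<Sum>l | mdeg l \<le> mdeg k. mcoeff F l * mcoeff (\<Prod>j\<in>UNIV. G j ^ (l $ j)) k)"

definition mfps_ideal :: "('p::finite \<Rightarrow> 'n::finite mfps) \<Rightarrow> 'n mfps set" where
  "mfps_ideal F = {\<Sum>a\<in>UNIV. H a * F a | H. True}"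

definition mfps_linear_part :: "('p::finite \<Rightarrow> 'n::finite mfps) \<Rightarrow> complex^'n^'p" where
  "mfps_linear_part F = (\<chi> a j. mcoeff (F a) (axis j 1))"

definition mmonom :: "complex^'n \<Rightarrow> nat^'n \<Rightarrow> complex" where
  "mmonom z k = (\<Prod>j\<in>UNIV. (z $ j) ^ (k $ j))"

definition mfps_summable_at :: "('p::finite \<Rightarrow> 'n::finite mfps) \<Rightarrow> complex^'n \<Rightarrow> bool" where
  "mfps_summable_at F z \<longleftrightarrow> (\<forall>a. (\<lambda>k. mcoeff (F a) k * mmonom z k) summable_on UNIV)"

definition mfps_converges :: "('p::finite \<Rightarrow> 'n::finite mfps) \<Rightarrow> bool" where
  "mfps_converges F \<longleftrightarrow> (\<exists>U. open U \<and> 0 \<in> U \<and> (\<forall>z\<in>U. mfps_summable_at F z))"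

definition mfps_eval :: "('p::finite \<Rightarrow> 'n::finite mfps) \<Rightarrow> complex^'n \<Rightarrow> complex^'p" where
  "mfps_eval F z = (\<chi> a. \<Sum>\<^sub>\<infinity>k. mcoeff (F a) k * mmonom z k)"

text \<open>\<open>G\<close> is the tuple of Taylor series at \<open>0\<close> of the components of \<open>g\<close>.\<close>
definition has_mfps_expansion :: "(complex^'n \<Rightarrow> complex^'p) \<Rightarrow> ('p \<Rightarrow> 'n mfps) \<Rightarrow> bool" where
  "has_mfps_expansion g G \<longleftrightarrow>
     (\<forall>\<^sub>F z in nhds 0. \<forall>a. ((\<lambda>k. mcoeff (G a) k * mmonom z k) has_sum g z $ a) UNIV)"

section \<open>Holomorphic maps, eigenvalues and invariant submanifolds\<close>

definition cholomorphic_on :: "(complex^'n \<Rightarrow> complex^'p) \<Rightarrow> (complex^'n) set \<Rightarrow> bool" where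
  "cholomorphic_on g U \<longleftrightarrow> (\<forall>z\<in>U. \<exists>J :: complex^'n^'p. (g has_derivative (*v) J) (at z))"

definition holomorphic_germ0 :: "(complex^'n \<Rightarrow> complex^'p) \<Rightarrow> bool" where
  "holomorphic_germ0 g \<longleftrightarrow> (\<exists>U. open U \<and> 0 \<in> U \<and> cholomorphic_on g U)"

definition eigenvalues_with_mult :: "complex^'n^'n \<Rightarrow> ('n \<Rightarrow> complex) \<Rightarrow> bool" where
  "eigenvalues_with_mult A ev \<longleftrightarrow> (\<forall>x. det (mat x - A) = (\<Prod>j\<in>UNIV. x - ev j))"

definition nonresonant :: "('n::finite \<Rightarrow> complex) \<Rightarrow> bool" where
  "nonresonant ev \<longleftrightarrow>
     (\<forall>j. \<forall>k :: nat^'n. mdeg k \<ge> 2 \<longrightarrow> ev j - (\<Prod>l\<in>UNIV. ev l ^ (k $ l)) \<noteq> 0)"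

definition formal_invariant_submanifold ::
  "(complex^'n \<Rightarrow> complex^'n) \<Rightarrow> ('p::finite \<Rightarrow> 'n mfps) \<Rightarrow> bool" where
  "formal_invariant_submanifold g F \<longleftrightarrow>
     (\<forall>a. mcoeff (F a) 0 = 0) \<and>
     rank (mfps_linear_part F) = CARD('p) \<and>
     (\<exists>G. has_mfps_expansion g G \<and> (\<forall>a. mfps_compose (F a) G \<in> mfps_ideal F))"

text \<open>
  On the open set \<open>U\<close>, \<open>\<Phi>\<close> is holomorphic and a submersion at each of its zeros, so that
  \<open>{z \<in> U. \<Phi> z = 0}\<close> is a complex submanifold of \<open>U\<close> with equation \<open>\<Phi> = 0\<close>.
\<close>
definition submanifold_equation :: "(complex^'n \<Rightarrow> complex^'p) \<Rightarrow> (complex^'n) set \<Rightarrow> bool" where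
  "submanifold_equation \<Phi> U \<longleftrightarrow>
     open U \<and> cholomorphic_on \<Phi> U \<and>
     (\<forall>z\<in>U. \<Phi> z = 0 \<longrightarrow>
        (\<exists>J :: complex^'n^'p. (\<Phi> has_derivative (*v) J) (at z) \<and> rank J = CARD('p)))"

text \<open>Invariance is that of the germ at \<open>0\<close>, as \<open>g\<close> is only given near \<open>0\<close>.\<close>
definition defines_invariant_submanifold ::
  "(complex^'n \<Rightarrow> complex^'n) \<Rightarrow> ('p::finite \<Rightarrow> 'n mfps) \<Rightarrow> bool" where
  "defines_invariant_submanifold g F \<longleftrightarrow>
     (\<exists>U. 0 \<in> U \<and> (\<forall>z\<in>U. mfps_summable_at F z) \<and>
        submanifold_equation (mfps_eval F) U \<and> mfps_eval F 0 = 0 \<and>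
        (\<forall>\<^sub>F z in nhds 0. z \<in> {z\<in>U. mfps_eval F z = 0} \<longrightarrow> g z \<in> {z\<in>U. mfps_eval F z = 0}))"

section \<open>The parameter space\<close>

text \<open>
  Since \<open>\<Gamma>\<close>-capacity relates different dimensions, \<open>\<complex>\<^sup>m\<close> is represented by the extensional
  functions on \<open>{..<m}\<close>, and likewise for the multi-indices in \<open>\<nat>\<^sup>m\<close>.
\<close>
definition cspace :: "nat \<Rightarrow> (nat \<Rightarrow> complex) set" where
  "cspace m = {..<m} \<rightarrow>\<^sub>E UNIV"

definition mindices :: "nat \<Rightarrow> (nat \<Rightarrow> nat) set" where
  "mindices m = {..<m} \<rightarrow>\<^sub>E UNIV"

lemma finite_mindices_le: "finite {i. i \<in> mindices m \<and> (\<Sum>j<m. i j) \<le> d}"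
proof (rule finite_subset)
  show "{i. i \<in> mindices m \<and> (\<Sum>j<m. i j) \<le> d} \<subseteq> {..<m} \<rightarrow>\<^sub>E {..d}"
  proof
    fix i assume "i \<in> {i. i \<in> mindices m \<and> (\<Sum>j<m. i j) \<le> d}"
    then have i: "i \<in> {..<m} \<rightarrow>\<^sub>E UNIV" and le: "(\<Sum>j<m. i j) \<le> d"
      by (auto simp: mindices_def)
    have "i j \<le> d" if "j < m" for j
    proof -
      have "i j \<le> (\<Sum>j<m. i j)" using that by (intro member_le_sum) auto
      then show ?thesis using le by simp
    qed
    then show "i \<in> {..<m} \<rightarrow>\<^sub>E {..d}" using i by (auto simp: PiE_iff)
  qed
qed (intro finite_PiE; simp)

lemma finite_mindices_less:
  "finite {i. i \<in> mindices m \<and> real (\<Sum>j<m. i j) < B}"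
proof (rule finite_subset [OF _ finite_mindices_le])
  show "{i. i \<in> mindices m \<and> real (\<Sum>j<m. i j) < B} \<subseteq>
      {i. i \<in> mindices m \<and> (\<Sum>j<m. i j) \<le> nat \<lceil>B\<rceil>}"
  proof
    fix i assume i: "i \<in> {i. i \<in> mindices m \<and> real (\<Sum>j<m. i j) < B}"
    then have "real (\<Sum>j<m. i j) \<le> B" by simp
    also have "B \<le> real (nat \<lceil>B\<rceil>)" by (rule real_nat_ceiling_ge)
    finally have "(\<Sum>j<m. i j) \<le> nat \<lceil>B\<rceil>" by (simp only: of_nat_le_iff)
    with i show "i \<in> {i. i \<in> mindices m \<and> (\<Sum>j<m. i j) \<le> nat \<lceil>B\<rceil>}" by simp
  qed
qed

definition tpow :: "nat \<Rightarrow> (nat \<Rightarrow> complex) \<Rightarrow> (nat \<Rightarrow> nat) \<Rightarrow> complex" where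
  "tpow m t i = (\<Prod>j<m. t j ^ i j)"

definition polynomial_of_degree_less ::
  "nat \<Rightarrow> real \<Rightarrow> ((nat \<Rightarrow> complex) \<Rightarrow> complex) \<Rightarrow> bool" where
  "polynomial_of_degree_less m B P \<longleftrightarrow>
     (\<exists>c. \<forall>t\<in>cspace m. P t = (\<Sum>i | i \<in> mindices m \<and> real (\<Sum>j<m. i j) < B. c i * tpow m t i))"

section \<open>Capacity\<close>

definition log_kernel :: "complex \<Rightarrow> complex \<Rightarrow> ereal" where
  "log_kernel z w = (if z = w then -\<infinity> else ereal (ln (cmod (z - w))))"

text \<open>
  \<open>I(\<mu>)\<close> with values in \<open>[-\<infinity>, \<infinity>)\<close>: the positive part of the kernel minus the negative part
  (\<open>e2ennreal\<close> truncates at \<open>0\<close>); the positive part has finite integral for compactly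
  supported probability measures.
\<close>
definition log_energy :: "complex measure \<Rightarrow> ereal" where
  "log_energy \<mu> =
     enn2ereal (\<integral>\<^sup>+z. \<integral>\<^sup>+w. e2ennreal (log_kernel z w) \<partial>\<mu> \<partial>\<mu>) -
     enn2ereal (\<integral>\<^sup>+z. \<integral>\<^sup>+w. e2ennreal (- log_kernel z w) \<partial>\<mu> \<partial>\<mu>)"

definition exp_ereal :: "ereal \<Rightarrow> ennreal" where
  "exp_ereal x = (case x of ereal r \<Rightarrow> ennreal (exp r) | PInfty \<Rightarrow> \<infinity> | MInfty \<Rightarrow> 0)"

text \<open>
  A Borel measure has compact support contained in \<open>E\<close> iff some compact \<open>K \<subseteq> E\<close> carries it.
  The supremum lies in \<open>[0, \<infinity>]\<close> and is \<open>0\<close> for \<open>E = {}\<close>.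
\<close>
definition log_capacity :: "complex set \<Rightarrow> ennreal" where
  "log_capacity E =
     (SUP \<mu>\<in>{\<mu>. prob_space \<mu> \<and> sets \<mu> = sets borel \<and>
                 (\<exists>K. compact K \<and> K \<subseteq> E \<and> emeasure \<mu> (- K) = 0)}.
        exp_ereal (log_energy \<mu>))"

definition Gamma_step :: "nat \<Rightarrow> (nat \<Rightarrow> complex) set \<Rightarrow> (nat \<Rightarrow> complex) set" where
  "Gamma_step k E = {z \<in> cspace k. log_capacity {w. z(k := w) \<in> E} > 0}"

text \<open>
  \<open>Gamma1 m E\<close> is \<open>\<Gamma>\<^sub>m\<^sup>1(E)\<close>; \<open>Gamma_step k\<close> goes from \<open>\<complex>\<^sup>k\<^sup>+\<^sup>1\<close> to \<open>\<complex>\<^sup>k\<close>. The value at \<open>m = 0\<close> is irrelevant.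
\<close>
fun Gamma1 :: "nat \<Rightarrow> (nat \<Rightarrow> complex) set \<Rightarrow> complex set" where
  "Gamma1 0 E = {}"
| "Gamma1 (Suc 0) E = {w. (\<lambda>i\<in>{..<1}. w) \<in> E}"
| "Gamma1 (Suc (Suc k)) E = Gamma1 (Suc k) (Gamma_step (Suc k) E)"

definition unitary_matrices :: "nat \<Rightarrow> (nat \<Rightarrow> nat \<Rightarrow> complex) set" where
  "unitary_matrices m =
     {U. \<forall>i<m. \<forall>j<m. (\<Sum>k<m. U i k * cnj (U j k)) = (if i = j then 1 else 0)}"

definition apply_matrix :: "nat \<Rightarrow> (nat \<Rightarrow> nat \<Rightarrow> complex) \<Rightarrow> (nat \<Rightarrow> complex) \<Rightarrow> (nat \<Rightarrow> complex)" where
  "apply_matrix m U z = (\<lambda>i\<in>{..<m}. \<Sum>j<m. U i j * z j)"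

definition Gamma_capacity :: "nat \<Rightarrow> (nat \<Rightarrow> complex) set \<Rightarrow> ennreal" where
  "Gamma_capacity m E =
     (SUP U\<in>unitary_matrices m. log_capacity (Gamma1 m (apply_matrix m U ` E)))"

end

theory Submission
  imports
    Defs
    "HOL-Complex_Analysis.Conformal_Mappings"
    "HOL-Computational_Algebra.Fundamental_Theorem_Algebra"
begin

text \<open>
  Let \<open>E\<close> be the set of parameters for which \<open>F\<^sub>t\<close> converges. It is a countable union of compact
  sets on which the coefficients of \<open>F\<^sub>t\<close> are bounded geometrically. If \<open>E\<close> has positive
  \<open>\<Gamma>\<close>-capacity, then in suitable unitary coordinates one of these sets is thick enough for a
  Bernstein-Walsh inequality: a polynomial of degree \<open>D\<close> bounded by \<open>M\<close> on it is at most \<open>C\<^sub>t\<^sup>D M\<close>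
  at \<open>t\<close>. As the degrees of the coefficients grow linearly in the valuation, \<open>F\<^sub>t\<close> converges for
  every \<open>t\<close>.

  Invariance: if \<open>F \<circ> f\<close> lies in the formal ideal of \<open>F\<close>, truncating the cofactors shows that
  \<open>F \<circ> f\<close> is \<open>O(\<bar>z\<bar>\<^sup>N)\<close> on \<open>{F = 0}\<close> for every \<open>N\<close>. It vanishes there by the identity theorem along
  holomorphic discs in \<open>{F = 0}\<close> through \<open>0\<close>.
\<close>

text \<open>Neither \<open>E\<close> nor the sets \<open>Gamma_step k E\<close> come with any
  measurability, so they are never handled directly. They are only covered by countably many compact
  sets, and positive capacity singles out one member of the cover. Thickness constants are taken of
  the form 1/(n+1) so that the covers stay countable through every reduction of the dimension. The
  Bernstein-Walsh constant may depend on \<open>t\<close> in any way, because convergence is claimed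
  for each \<open>t\<close> separately. For invariance the obstacle is that the cofactors in the
  ideal are formal and may diverge, so that the ideal relation cannot be evaluated at a point. Each
  finite order yields an estimate, but on a neighbourhood that may shrink with the order. Discs
  remove this dependence: flatness at the centre forces vanishing on the whole disc. They are images
  of complex lines under the inverse of a chart in which F becomes linear, so they reach every zero
  of F in a fixed neighbourhood of 0.\<close>

unbundle no fps_syntax

section \<open>Thick sets and logarithmic capacity\<close>

text \<open>For compact \<open>S\<close>, thickness means that the Chebyshev constant is at least \<open>c\<close>. Unlike capacity
  it visibly passes to limits of compact sets, so that no weak compactness of measures is needed.\<close>
definition thick :: "real \<Rightarrow> complex set \<Rightarrow> bool" where
  "thick c S \<longleftrightarrow> (\<forall>A. \<exists>w\<in>S. c ^ size A \<le> (\<Prod>x\<in>#A. cmod (w - x)))"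

lemma thick_mono: "thick c S \<Longrightarrow> 0 \<le> c' \<Longrightarrow> c' \<le> c \<Longrightarrow> S \<subseteq> T \<Longrightarrow> thick c' T"
  unfolding thick_def by (meson order_trans power_mono subsetD)

lemma thick_nonempty: "thick c S \<Longrightarrow> S \<noteq> {}"
  unfolding thick_def by blast

lemma prod_mset_mono_real:
  fixes f g :: "'a \<Rightarrow> real"
  assumes "\<And>x. x \<in># A \<Longrightarrow> 0 \<le> f x \<and> f x \<le> g x"
  shows "0 \<le> (\<Prod>x\<in>#A. f x) \<and> (\<Prod>x\<in>#A. f x) \<le> (\<Prod>x\<in>#A. g x)"
  using assms
proof (induction A)
  case (add x A)
  then have "0 \<le> f x" "f x \<le> g x" "0 \<le> (\<Prod>x\<in>#A. f x)" "(\<Prod>x\<in>#A. f x) \<le> (\<Prod>x\<in>#A. g x)"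
    by auto
  then show ?case by (auto intro!: mult_mono)
qed simp

text \<open>
  Large roots are harmless, since \<open>\<bar>t - r\<bar>\<close> and \<open>\<bar>w - r\<bar>\<close> are comparable for \<open>w\<close> in a bounded
  set; the thickness condition takes care of the others.
\<close>
lemma thick_poly_growth:
  fixes c R T :: real
  assumes c: "0 < c" and R: "0 \<le> R" and T: "0 \<le> T"
  obtains C where "C \<ge> 1"
    "\<And>S q D M t. thick c S \<Longrightarrow> S \<subseteq> cball 0 R \<Longrightarrow> degree q \<le> D \<Longrightarrow>
       (\<And>w. w \<in> S \<Longrightarrow> cmod (poly q w) \<le> M) \<Longrightarrow> cmod t \<le> T \<Longrightarrow> cmod (poly q t) \<le> C ^ D * M"
proof
  \<comment> \<open>For \<open>cmod x \<ge> r0\<close> one has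
    \<open>T + cmod x \<le> 2 * (cmod x - R)\<close>, so a far root costs a factor 2; a near root
    costs at most \<open>(T + r0) / c\<close> relative to \<open>c\<close>. The constant
    \<open>C\<close> is the larger of the two.\<close>
  define r0 where "r0 = 2 * (R + T + 1)"
  define C where "C = max 2 ((T + r0) / c)"
  show C1: "C \<ge> 1" unfolding C_def by simp
  fix S :: "complex set" and q :: "complex poly" and D :: nat and M :: real and t :: complex
  assume th: "thick c S" and SR: "S \<subseteq> cball 0 R" and deg: "degree q \<le> D"
    and bd: "\<And>w. w \<in> S \<Longrightarrow> cmod (poly q w) \<le> M" and tT: "cmod t \<le> T"
  have M: "0 \<le> M" using bd thick_nonempty[OF th] norm_ge_zero order_trans by blast
  define A where "A = proots q"
  define B where "B = filter_mset (\<lambda>x. cmod x \<ge> r0) A"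
  define B' where "B' = filter_mset (\<lambda>x. \<not> cmod x \<ge> r0) A"
  have AB: "A = B + B'" unfolding B_def B'_def by (rule multiset_partition)
  have val: "cmod (poly q u) = cmod (lead_coeff q) * (\<Prod>x\<in>#A. cmod (u - x))" for u
  proof -
    have "poly q u = poly (smult (lead_coeff q) (\<Prod>x\<in>#A. [:-x, 1:])) u"
      unfolding A_def by (simp only: complex_poly_decompose_multiset)
    moreover have "poly (\<Prod>x\<in>#A. [:-x, 1:]) u = (\<Prod>x\<in>#A. u - x)"
      by (induction A) (simp_all add: algebra_simps)
    moreover have "cmod (\<Prod>x\<in>#A. u - x) = (\<Prod>x\<in>#A. cmod (u - x))"
      by (induction A) (simp_all add: norm_mult)
    ultimately show ?thesis by (simp add: norm_mult)
  qed
  \<comment> \<open>A single \<open>w\<close> must serve all roots. It is chosen for the near roots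
    only, since the comparison for the far roots holds at every point of
    \<open>cball 0 R\<close>.\<close>
  obtain w where w: "w \<in> S" and wc: "c ^ size B' \<le> (\<Prod>x\<in>#B'. cmod (w - x))"
    using th unfolding thick_def by blast
  have wR: "cmod w \<le> R" using w SR by auto
  have "(\<Prod>x\<in>#B'. cmod (t - x)) \<le> (\<Prod>x\<in>#B'. C * c)"
  proof (rule conjunct2[OF prod_mset_mono_real])
    fix x assume "x \<in># B'"
    then have "cmod x < r0" by (simp add: B'_def)
    then have "cmod (t - x) \<le> T + r0" using tT norm_triangle_ineq4[of t x] by linarith
    also have "\<dots> \<le> C * c" using c unfolding C_def by (simp add: max_def field_simps)
    finally show "0 \<le> cmod (t - x) \<and> cmod (t - x) \<le> C * c" by simp
  qed
  also have "\<dots> = C ^ size B' * c ^ size B'" by (simp add: power_mult_distrib)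
  also have "\<dots> \<le> C ^ size B' * (\<Prod>x\<in>#B'. cmod (w - x))"
    using wc C1 by (intro mult_left_mono) auto
  finally have 1: "(\<Prod>x\<in>#B'. cmod (t - x)) \<le> C ^ size B' * (\<Prod>x\<in>#B'. cmod (w - x))" .
  have "(\<Prod>x\<in>#B. cmod (t - x)) \<le> (\<Prod>x\<in>#B. C * cmod (w - x))"
  proof (rule conjunct2[OF prod_mset_mono_real])
    fix x assume "x \<in># B"
    then have x: "cmod x \<ge> r0" by (simp add: B_def)
    have "cmod (t - x) \<le> T + cmod x" using tT norm_triangle_ineq4[of t x] by linarith
    also have "\<dots> \<le> 2 * (cmod x - R)" using x R T unfolding r0_def by (smt (verit))
    also have "\<dots> \<le> 2 * cmod (w - x)" using wR norm_triangle_ineq2[of x w] by (simp add: norm_minus_commute)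
    also have "\<dots> \<le> C * cmod (w - x)" unfolding C_def by (intro mult_right_mono) auto
    finally show "0 \<le> cmod (t - x) \<and> cmod (t - x) \<le> C * cmod (w - x)" by simp
  qed
  also have "\<dots> = C ^ size B * (\<Prod>x\<in>#B. cmod (w - x))"
    by (simp add: prod_mset.distrib)
  finally have 2: "(\<Prod>x\<in>#B. cmod (t - x)) \<le> C ^ size B * (\<Prod>x\<in>#B. cmod (w - x))" .
  have nn: "0 \<le> (\<Prod>x\<in>#X. cmod (u - x))" for X u by (rule conjunct1[OF prod_mset_mono_real]) auto
  have sz: "size B + size B' \<le> D"
  proof -
    have "size A \<le> degree q" unfolding A_def by (rule size_proots_le)
    then show ?thesis using deg AB by simp
  qed
  have "cmod (poly q t) = cmod (lead_coeff q) * ((\<Prod>x\<in>#B. cmod (t - x)) * (\<Prod>x\<in>#B'. cmod (t - x)))"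
    unfolding val AB by simp
  also have "\<dots> \<le> cmod (lead_coeff q) * ((C ^ size B * (\<Prod>x\<in>#B. cmod (w - x))) *
      (C ^ size B' * (\<Prod>x\<in>#B'. cmod (w - x))))"
    using 1 2 nn C1 by (intro mult_left_mono mult_mono) auto
  also have "\<dots> = C ^ (size B + size B') * cmod (poly q w)"
    unfolding val AB by (simp add: power_add)
  also have "\<dots> \<le> C ^ D * M"
    using sz C1 M bd[OF w] by (intro mult_mono power_increasing) auto
  finally show "cmod (poly q t) \<le> C ^ D * M" .
qed

section \<open>Logarithmic potentials and measures of finite energy\<close>

abbreviation log_minus :: "complex \<Rightarrow> complex \<Rightarrow> ennreal" where
  "log_minus z w \<equiv> e2ennreal (- log_kernel z w)"

lemma log_kernel_measurable:
  "case_prod log_kernel \<in> borel_measurable (borel \<Otimes>\<^sub>M borel)"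
  unfolding log_kernel_def case_prod_unfold by measurable

lemma log_minus_measurable [measurable]:
  assumes [measurable]: "f \<in> borel_measurable M" "g \<in> borel_measurable M"
  shows "(\<lambda>x. log_minus (f x) (g x)) \<in> borel_measurable M"
proof -
  have "(\<lambda>x. case_prod log_kernel (f x, g x)) \<in> borel_measurable M"
    by (rule measurable_compose[OF _ log_kernel_measurable]) measurable
  then show ?thesis by simp
qed

text \<open>Moving \<open>z\<close> to a point \<open>a\<close> that at most doubles the distance to
  \<open>w\<close> costs only ln 2. This gives a weak form of the maximum principle for potentials:
  a bound on the support spreads to the whole plane up to a constant.\<close>

lemma log_minus_nearest:
  assumes "cmod (a - w) \<le> 2 * cmod (z - w)"
  shows "log_minus z w \<le> ennreal (ln 2) + log_minus a w"
proof (cases "a = w \<or> z = w")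
  case True
  then show ?thesis using assms by (auto simp: log_kernel_def)
next
  case False
  then have "ln (cmod (a - w)) \<le> ln (2 * cmod (z - w))" using assms by (subst ln_le_cancel_iff) auto
  also have "\<dots> = ln 2 + ln (cmod (z - w))" using False by (simp add: ln_mult)
  finally have "ennreal (- ln (cmod (z - w))) \<le> ennreal (ln 2 + max 0 (- ln (cmod (a - w))))"
    by (intro ennreal_leI) auto
  also have "\<dots> = ennreal (ln 2) + ennreal (- ln (cmod (a - w)))"
    by (subst ennreal_plus) (auto simp: ennreal_max_0)
  finally show ?thesis using False by (simp add: log_kernel_def)
qed

lemma log_minus_lower: "log_minus x w \<le> ennreal L \<Longrightarrow> 0 \<le> L \<Longrightarrow> exp (- L) \<le> cmod (w - x)"
proof (cases "x = w")
  case False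
  assume "log_minus x w \<le> ennreal L" "0 \<le> L"
  then have "- ln (cmod (x - w)) \<le> L" using False
    by (auto simp: log_kernel_def e2ennreal_ereal ennreal_le_iff2)
  then have "- L \<le> ln (cmod (x - w))" by linarith
  then have "exp (- L) \<le> exp (ln (cmod (x - w)))" by (rule iffD2[OF exp_le_cancel_iff])
  then show ?thesis using False by (simp add: norm_minus_commute)
qed (auto simp: log_kernel_def top_unique)

text \<open>The bridge from potentials to thickness: exponentiating a bound on a sum of kernels
  gives a lower bound for a product of distances. Truncating the kernel at 0 is harmless, since it
  only makes the sum larger.\<close>

lemma log_minus_sum_lower:
  "(\<Sum>x\<in>#A. log_minus x w) \<le> ennreal s \<Longrightarrow> 0 \<le> s \<Longrightarrow> exp (- s) \<le> (\<Prod>x\<in>#A. cmod (w - x))"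
proof (induction A arbitrary: s)
  case (add x A)
  let ?S = "\<Sum>y\<in>#A. log_minus y w"
  have sum: "log_minus x w + ?S \<le> ennreal s" using add.prems by simp
  have "log_minus x w + ?S < top" using sum ennreal_less_top by (rule le_less_trans)
  then have "log_minus x w < top" "?S < top" by auto
  then obtain u v where u: "log_minus x w = ennreal u" "0 \<le> u" and v: "?S = ennreal v" "0 \<le> v"
    by (cases "log_minus x w"; cases ?S) auto
  have "u + v \<le> s" using sum u v add.prems by (simp flip: ennreal_plus)
  then have "exp (- s) \<le> exp (- u) * exp (- v)" by (simp flip: exp_add)
  also have "\<dots> \<le> cmod (w - x) * (\<Prod>y\<in>#A. cmod (w - y))"
    using log_minus_lower[of x w u] add.IH[of v] u v by (intro mult_mono) auto
  finally show ?case by simp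
qed simp

text \<open>On a compact set the positive part of the kernel is bounded, so an infinite negative
  part would make the energy -\<infinity> and its exponential 0.\<close>

lemma finite_energy_of_capacity:
  assumes "log_capacity E > 0"
  obtains \<mu> K where "prob_space \<mu>" "sets \<mu> = sets borel" "compact K" "K \<subseteq> E" "emeasure \<mu> (- K) = 0"
    "(\<integral>\<^sup>+z. \<integral>\<^sup>+w. log_minus z w \<partial>\<mu> \<partial>\<mu>) \<noteq> \<infinity>"
proof -
  obtain \<mu> K where \<mu>: "prob_space \<mu>" "sets \<mu> = sets borel" and K: "compact K" "K \<subseteq> E" "emeasure \<mu> (- K) = 0"
    and pos: "exp_ereal (log_energy \<mu>) > 0"
    using assms unfolding log_capacity_def less_SUP_iff by blast
  interpret prob_space \<mu> by fact
  have [measurable_cong]: "sets \<mu> = sets borel" by fact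
  obtain R where R: "\<And>z. z \<in> K \<Longrightarrow> cmod z \<le> R" "0 \<le> R"
    using compact_imp_bounded[OF K(1)] unfolding bounded_pos by (meson less_imp_le)
  have K_AE: "AE z in \<mu>. z \<in> K"
    using K by (intro AE_I[of _ _ "- K"]) (auto simp: \<mu> intro: borel_comp[OF borel_compact])
  have bd: "e2ennreal (log_kernel z w) \<le> ennreal (ln (2 * R + 1))" if "z \<in> K" "w \<in> K" for z w
  proof (cases "z = w")
    case False
    have "cmod (z - w) \<le> 2 * R + 1" using R(1)[OF that(1)] R(1)[OF that(2)] norm_triangle_ineq4[of z w] by linarith
    then have "ln (cmod (z - w)) \<le> ln (2 * R + 1)" using False R by (subst ln_le_cancel_iff) auto
    then show ?thesis using False by (auto simp: log_kernel_def intro: ennreal_leI)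
  qed (simp add: log_kernel_def e2ennreal_neg)
  have "(\<integral>\<^sup>+z. \<integral>\<^sup>+w. e2ennreal (log_kernel z w) \<partial>\<mu> \<partial>\<mu>) \<le> (\<integral>\<^sup>+z. \<integral>\<^sup>+w. ennreal (ln (2 * R + 1)) \<partial>\<mu> \<partial>\<mu>)"
    using K_AE
  proof (intro nn_integral_mono_AE, eventually_elim)
    case (elim z)
    show ?case using K_AE by (intro nn_integral_mono_AE, eventually_elim) (use elim bd in auto)
  qed
  also have "\<dots> < \<infinity>" using emeasure_space_1 sets_eq_imp_space_eq[OF \<mu>(2)] by (simp add: ennreal_mult_less_top)
  finally have fin: "enn2ereal (\<integral>\<^sup>+z. \<integral>\<^sup>+w. e2ennreal (log_kernel z w) \<partial>\<mu> \<partial>\<mu>) \<noteq> \<infinity>"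
    by (simp add: enn2ereal_eq_top_iff)
  have "(\<integral>\<^sup>+z. \<integral>\<^sup>+w. log_minus z w \<partial>\<mu> \<partial>\<mu>) \<noteq> \<infinity>"
  proof
    assume inf: "(\<integral>\<^sup>+z. \<integral>\<^sup>+w. log_minus z w \<partial>\<mu> \<partial>\<mu>) = \<infinity>"
    have "enn2ereal \<infinity> = \<infinity>" by (simp add: enn2ereal_eq_top_iff)
    then have "log_energy \<mu> = - \<infinity>" unfolding log_energy_def inf using fin
      by (cases "enn2ereal (\<integral>\<^sup>+z. \<integral>\<^sup>+w. e2ennreal (log_kernel z w) \<partial>\<mu> \<partial>\<mu>)") auto
    then show False using pos by (simp add: exp_ereal_def)
  qed
  then show thesis using that \<mu> K by blast
qed

text \<open>Restrict a measure of finite energy to a compact set on which its potential is bounded. The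
  restricted potential is then bounded on all of \<open>\<complex>\<close>, by comparison with the nearest point of that set.\<close>
lemma thick_of_capacity:
  assumes cap: "log_capacity E > 0" and cnt: "countable \<A>" and cl: "\<And>S. S \<in> \<A> \<Longrightarrow> closed S"
    and cov: "E \<subseteq> \<Union>\<A>"
  obtains S n where "S \<in> \<A>" "thick (1 / real (Suc n)) S"
proof -
  obtain \<mu> K where \<mu>: "prob_space \<mu>" "sets \<mu> = sets borel" and K: "compact K" "K \<subseteq> E" "emeasure \<mu> (- K) = 0"
    and fin: "(\<integral>\<^sup>+z. \<integral>\<^sup>+w. log_minus z w \<partial>\<mu> \<partial>\<mu>) \<noteq> \<infinity>"
    using finite_energy_of_capacity[OF cap] .
  interpret prob_space \<mu> by fact
  have [measurable_cong]: "sets \<mu> = sets borel" by fact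
  have sp: "space \<mu> = UNIV" using \<mu>(2) by (simp add: sets_eq_imp_space_eq)
  have K_AE: "AE z in \<mu>. z \<in> K"
    using K by (intro AE_I[of _ _ "- K"]) (auto simp: \<mu> intro: borel_comp[OF borel_compact])
  define n where "n z = (\<integral>\<^sup>+w. log_minus z w \<partial>\<mu>)" for z
  have n_meas [measurable]: "n \<in> borel_measurable borel"
  proof -
    have "(\<lambda>z. \<integral>\<^sup>+w. log_minus z w \<partial>\<mu>) \<in> borel_measurable \<mu>"
      by (rule borel_measurable_nn_integral) measurable
    then show ?thesis unfolding n_def by measurable
  qed
  have "AE z in \<mu>. n z \<noteq> \<infinity>"
    using fin unfolding n_def[symmetric] by (intro nn_integral_noteq_infinite) auto
  then have cover: "AE z in \<mu>. \<exists>S\<in>\<A>. \<exists>L::nat. z \<in> S \<and> n z \<le> of_nat L"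
    using K_AE
  proof eventually_elim
    case (elim z)
    then obtain S where "S \<in> \<A>" "z \<in> S" using K cov by blast
    moreover obtain L :: nat where "n z < of_nat L" using elim
      by (metis ennreal_Ex_less_of_nat infinity_ennreal_def top.not_eq_extremum)
    ultimately show ?case using less_imp_le by blast
  qed
  \<comment> \<open>Almost every point lies in one of the countably many sets
    \<open>S \<inter> {z. n z \<le> of_nat L}\<close>, so they cannot all be null sets.\<close>
  have "\<exists>S\<in>\<A>. \<exists>L::nat. emeasure \<mu> (S \<inter> {z. n z \<le> of_nat L}) \<noteq> 0"
  proof (rule ccontr)
    assume neg: "\<not> ?thesis"
    have meas: "S \<inter> {z. n z \<le> of_nat L} \<in> sets \<mu>" if "S \<in> \<A>" for S and L :: nat
      using cl[OF that] unfolding \<mu> by (intro sets.Int) (auto intro: borel_closed)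
    have "AE z in \<mu>. \<forall>S\<in>\<A>. \<forall>L\<in>(UNIV :: nat set). z \<notin> S \<inter> {z. n z \<le> of_nat L}"
      unfolding AE_ball_countable[OF cnt] AE_ball_countable[OF countableI_type]
    proof (intro ballI)
      fix S and L :: nat assume "S \<in> \<A>"
      then show "AE z in \<mu>. z \<notin> S \<inter> {z. n z \<le> of_nat L}"
        using neg meas by (intro AE_not_in) (auto simp: null_sets_def)
    qed
    with cover have "AE z in \<mu>. False" by eventually_elim blast
    then show False by simp
  qed
  then obtain S and L :: nat where S: "S \<in> \<A>" and posm: "emeasure \<mu> (S \<inter> {z. n z \<le> of_nat L}) \<noteq> 0"
    by blast
  have "S \<inter> {z. n z \<le> of_nat L} \<in> sets borel"
    using cl[OF S] by (intro sets.Int) (auto intro: borel_closed)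
  \<comment> \<open>Compactness of \<open>K'\<close> provides the nearest points used below, while
    the potential stays at most \<open>L\<close> on it.\<close>
  from inner_regular[OF \<mu>(2) _ this] posm
  have "(SUP K \<in> {K. K \<subseteq> S \<inter> {z. n z \<le> of_nat L} \<and> compact K}. emeasure \<mu> K) > 0"
    by (simp add: emeasure_space_1 zero_less_iff_neq_zero)
  then obtain K' where K'S: "K' \<subseteq> S" and K'n: "\<And>z. z \<in> K' \<Longrightarrow> n z \<le> of_nat L" and K'c: "compact K'"
    and K'pos: "emeasure \<mu> K' > 0"
    unfolding less_SUP_iff by blast
  have [measurable]: "K' \<in> sets borel" using K'c by (rule borel_compact)
  define m where "m = measure \<mu> K'"
  have m: "emeasure \<mu> K' = ennreal m" "0 < m"
    unfolding m_def using K'pos by (auto simp: emeasure_eq_measure)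
  have K'ne: "K' \<noteq> {}" using K'pos by auto
  define B where "B = ln 2 + real L"
  have B0: "0 \<le> B" by (simp add: B_def)
  have pot: "(\<integral>\<^sup>+w. log_minus z w * indicator K' w \<partial>\<mu>) \<le> ennreal B" for z
  proof -
    obtain a where a: "a \<in> K'" and amin: "\<And>w. w \<in> K' \<Longrightarrow> dist z a \<le> dist z w"
      using distance_attains_inf[OF compact_imp_closed[OF K'c] K'ne] by blast
    have "(\<integral>\<^sup>+w. log_minus z w * indicator K' w \<partial>\<mu>) \<le> (\<integral>\<^sup>+w. ennreal (ln 2) + log_minus a w \<partial>\<mu>)"
    proof (intro nn_integral_mono)
      fix w
      have "log_minus z w \<le> ennreal (ln 2) + log_minus a w" if w: "w \<in> K'"
      proof (rule log_minus_nearest)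
        show "cmod (a - w) \<le> 2 * cmod (z - w)"
          using amin[OF w] dist_triangle[of a w z] by (simp add: dist_norm norm_minus_commute)
      qed
      then show "log_minus z w * indicator K' w \<le> ennreal (ln 2) + log_minus a w"
        by (auto simp: indicator_def)
    qed
    also have "\<dots> = ennreal (ln 2) + n a"
      unfolding n_def by (subst nn_integral_add) (auto simp: emeasure_space_1)
    also have "\<dots> \<le> ennreal (ln 2) + of_nat L" using K'n[OF a] by (intro add_left_mono)
    also have "\<dots> = ennreal B" unfolding B_def by (simp add: ennreal_of_nat_eq_real_of_nat)
    finally show ?thesis .
  qed
  have pot_sum: "(\<integral>\<^sup>+w. (\<Sum>x\<in>#A. log_minus x w) * indicator K' w \<partial>\<mu>) \<le> ennreal (real (size A) * B)" for A
  proof (induction A)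
    case (add x A)
    have [measurable]: "(\<lambda>w. \<Sum>x\<in>#A. log_minus x w) \<in> borel_measurable \<mu>"
      by (induction A) auto
    have "(\<integral>\<^sup>+w. (\<Sum>y\<in>#add_mset x A. log_minus y w) * indicator K' w \<partial>\<mu>) =
      (\<integral>\<^sup>+w. log_minus x w * indicator K' w + (\<Sum>y\<in>#A. log_minus y w) * indicator K' w \<partial>\<mu>)"
      by (simp add: distrib_right)
    also have "\<dots> = (\<integral>\<^sup>+w. log_minus x w * indicator K' w \<partial>\<mu>) +
        (\<integral>\<^sup>+w. (\<Sum>y\<in>#A. log_minus y w) * indicator K' w \<partial>\<mu>)"
      by (rule nn_integral_add) measurable
    also have "\<dots> \<le> ennreal B + ennreal (real (size A) * B)"
      by (intro add_mono pot add.IH)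
    also have "\<dots> = ennreal (real (size (add_mset x A)) * B)"
      using B0 by (simp add: distrib_right flip: ennreal_plus)
    finally show ?case .
  qed simp
  \<comment> \<open>Averaging over \<open>K'\<close>, of mass \<open>m\<close>, gives a point where
    the sum of potentials is at most \<open>size A * B / m\<close>. The added 1 turns the failure of
    this into a strict contradiction.\<close>
  define b where "b = B / m + 1"
  have b0: "0 \<le> b" using B0 m by (simp add: b_def)
  have "\<exists>w\<in>K'. (\<Sum>x\<in>#A. log_minus x w) \<le> ennreal (real (size A) * b)" for A
  proof (rule ccontr)
    assume neg: "\<not> ?thesis"
    then have A: "A \<noteq> {#}" using K'ne by auto
    have "ennreal (real (size A) * b) * ennreal m = (\<integral>\<^sup>+w. ennreal (real (size A) * b) * indicator K' w \<partial>\<mu>)"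
      using m by (simp add: nn_integral_cmult_indicator)
    also have "\<dots> \<le> (\<integral>\<^sup>+w. (\<Sum>x\<in>#A. log_minus x w) * indicator K' w \<partial>\<mu>)"
      using neg by (intro nn_integral_mono) (auto simp: indicator_def not_le intro: less_imp_le)
    also have "\<dots> \<le> ennreal (real (size A) * B)" by (rule pot_sum)
    finally have "real (size A) * b * m \<le> real (size A) * B"
      using m b0 B0 by (simp flip: ennreal_mult)
    then have "real (size A) * (b * m) \<le> real (size A) * B" by (simp add: mult.assoc)
    moreover have "0 < real (size A)" using A by (simp add: nonempty_has_size)
    ultimately have "b * m \<le> B" by (rule mult_left_le_imp_le)
    moreover have "b * m = B + m" using m by (simp add: b_def field_simps)
    ultimately show False using m by simp
  qed
  then have ex: "\<exists>w\<in>K'. (\<Sum>x\<in>#A. log_minus x w) \<le> ennreal (real (size A) * b)" for A .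
  have thick_exp: "thick (exp (- b)) S"
    unfolding thick_def
  proof
    fix A
    obtain w where w: "w \<in> K'" "(\<Sum>x\<in>#A. log_minus x w) \<le> ennreal (real (size A) * b)" using ex by blast
    have "exp (- b) ^ size A = exp (- (real (size A) * b))" by (simp flip: exp_of_nat_mult)
    also have "\<dots> \<le> (\<Prod>x\<in>#A. cmod (w - x))" using w(2) b0 by (intro log_minus_sum_lower) auto
    finally show "\<exists>w\<in>S. exp (- b) ^ size A \<le> (\<Prod>x\<in>#A. cmod (w - x))" using w(1) K'S by blast
  qed
  \<comment> \<open>The constant is lowered to a member of a countable family, so that later unions
    over all constants are countable.\<close>
  obtain k where "inverse (real (Suc k)) < exp (- b)" using reals_Archimedean[of "exp (- b)"] by auto
  then have "thick (1 / real (Suc k)) S" by (intro thick_mono[OF thick_exp]) (auto simp: inverse_eq_divide)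
  then show thesis using that S by blast
qed

section \<open>A Bernstein-Walsh inequality in several variables\<close>

definition separately_poly :: "nat \<Rightarrow> nat \<Rightarrow> ((nat \<Rightarrow> complex) \<Rightarrow> complex) \<Rightarrow> bool" where
  "separately_poly m D P \<longleftrightarrow>
     (\<forall>t\<in>cspace m. \<forall>j<m. \<exists>q. degree q \<le> D \<and> (\<forall>w. P (t(j := w)) = poly q w))"

text \<open>\<open>C\<close> depends on \<open>t\<close> but not on \<open>D\<close>,
  \<open>M\<close> or \<open>P\<close>. Degrees are bounded in each variable separately because the
  induction moves one coordinate at a time, and this bound survives freezing a coordinate.\<close>

definition bernstein_walsh :: "nat \<Rightarrow> (nat \<Rightarrow> complex) set \<Rightarrow> bool" where
  "bernstein_walsh m K \<longleftrightarrow> (\<forall>t\<in>cspace m. \<exists>C\<ge>1. \<forall>D M P.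
     separately_poly m D P \<longrightarrow> (\<forall>s\<in>K. cmod (P s) \<le> M) \<longrightarrow> cmod (P t) \<le> C ^ D * M)"

definition slice :: "nat \<Rightarrow> (nat \<Rightarrow> complex) set \<Rightarrow> (nat \<Rightarrow> complex) \<Rightarrow> complex set" where
  "slice k K z = {w. z(k := w) \<in> K}"

lemma cspace_Suc_upd: "z \<in> cspace k \<Longrightarrow> z(k := w) \<in> cspace (Suc k)"
  unfolding cspace_def by (auto simp: PiE_iff extensional_def)

text \<open>Resetting coordinate \<open>k\<close> to \<open>undefined\<close> is the projection that
  forgets the last coordinate, in the extensional representation.\<close>

lemma cspace_Suc_restrict: "t \<in> cspace (Suc k) \<Longrightarrow> t(k := undefined) \<in> cspace k"
  unfolding cspace_def by (auto simp: PiE_iff extensional_def)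

lemma cspace_restrict_upd: "z \<in> cspace k \<Longrightarrow> z(k := undefined) = z"
  unfolding cspace_def by (auto simp: PiE_iff extensional_def fun_eq_iff)

lemma bernstein_walsh_0: "bernstein_walsh 0 (cspace 0)"
  unfolding bernstein_walsh_def by (auto intro!: exI[of _ 1])

lemma continuous_on_coordinate: "continuous_on S (\<lambda>t::nat \<Rightarrow> complex. t k)"
  by (rule continuous_on_subset[OF continuous_on_product_coordinates]) simp

lemma continuous_on_fun_upd_const:
  "continuous_on S (\<lambda>t::nat \<Rightarrow> complex. t(k := c))"
proof (rule continuous_on_coordinatewise_then_product)
  fix i show "continuous_on S (\<lambda>t. (t(k := c)) i)"
    by (cases "i = k") (simp_all add: continuous_on_coordinate)
qed

lemma continuous_on_fun_upd:
  "continuous_on S (\<lambda>w. (z::nat \<Rightarrow> complex)(k := w))"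
proof (rule continuous_on_coordinatewise_then_product)
  fix i show "continuous_on S (\<lambda>w. (z(k := w)) i)"
    by (cases "i = k") simp_all
qed

lemma compact_slice:
  assumes "compact K"
  shows "compact (slice k K z)"
proof -
  have "closed ((\<lambda>w. z(k := w)) -` K)"
    by (rule closed_vimage[OF compact_imp_closed[OF assms] continuous_on_fun_upd])
  moreover have "bounded ((\<lambda>t. t k) ` K)"
    by (intro compact_imp_bounded compact_continuous_image assms continuous_on_coordinate)
  moreover have "slice k K z \<subseteq> (\<lambda>t. t k) ` K"
    unfolding slice_def by (force intro: rev_image_eqI)
  ultimately have "bounded (slice k K z)" "closed (slice k K z)"
    by (simp_all add: bounded_subset slice_def vimage_def)
  then show ?thesis by (simp add: compact_eq_bounded_closed)
qed

lemma continuous_on_prod_mset_norm: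
  assumes "continuous_on S f"
  shows "continuous_on S (\<lambda>t. \<Prod>x\<in>#A. cmod (f t - x))"
  by (induction A) (auto intro!: continuous_intros assms)

text \<open>Thickness of the slice is the conjunction, over all multisets of points, of conditions on
  the projection of a compact set.\<close>
lemma compact_thick_slices:
  assumes K: "compact K" "K \<subseteq> cspace (Suc k)"
  shows "compact {z \<in> cspace k. thick c (slice k K z)}"
proof -
  define L where "L A = K \<inter> {t. c ^ size A \<le> (\<Prod>x\<in>#A. cmod (t k - x))}" for A
  define p where "p t = t(k := undefined)" for t :: "nat \<Rightarrow> complex"
  have "compact (p ` L A)" for A
  proof (intro compact_continuous_image)
    show "continuous_on (L A) p" unfolding p_def by (rule continuous_on_fun_upd_const)
    have "closed {t::nat \<Rightarrow> complex. c ^ size A \<le> (\<Prod>x\<in>#A. cmod (t k - x))}"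
      by (intro closed_Collect_le continuous_on_const continuous_on_prod_mset_norm
          continuous_on_coordinate)
    then show "compact (L A)" unfolding L_def using K compact_Int_closed by blast
  qed
  then have "compact (p ` L {#} \<inter> (\<Inter>A. p ` L A))"
    by (intro compact_Int_closed closed_INT) (auto intro: compact_imp_closed)
  moreover have "p ` L {#} \<inter> (\<Inter>A. p ` L A) = (\<Inter>A. p ` L A)" by blast
  moreover have "{z \<in> cspace k. thick c (slice k K z)} = (\<Inter>A. p ` L A)"
  proof (intro equalityI subsetI)
    fix z assume z: "z \<in> {z \<in> cspace k. thick c (slice k K z)}"
    show "z \<in> (\<Inter>A. p ` L A)"
    proof
      fix A
      obtain w where "z(k := w) \<in> K" "c ^ size A \<le> (\<Prod>x\<in>#A. cmod (w - x))"
        using z unfolding thick_def slice_def by blast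
      then have "z(k := w) \<in> L A" unfolding L_def by simp
      moreover have "p (z(k := w)) = z" unfolding p_def using z cspace_restrict_upd by simp
      ultimately show "z \<in> p ` L A" by (metis rev_image_eqI)
    qed
  next
    fix z assume z: "z \<in> (\<Inter>A. p ` L A)"
    have ex: "\<exists>t. t \<in> K \<and> c ^ size A \<le> (\<Prod>x\<in>#A. cmod (t k - x)) \<and> z = t(k := undefined)" for A
      using z unfolding L_def p_def by blast
    have "z \<in> cspace k" using ex[of "{#}"] K cspace_Suc_restrict by blast
    moreover have "thick c (slice k K z)"
      unfolding thick_def slice_def
    proof
      fix A
      obtain t where t: "t \<in> K" "c ^ size A \<le> (\<Prod>x\<in>#A. cmod (t k - x))" "z = t(k := undefined)"
        using ex by blast
      have "z(k := t k) = t" using t by simp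
      then show "\<exists>w\<in>{w. z(k := w) \<in> K}. c ^ size A \<le> (\<Prod>x\<in>#A. cmod (w - x))"
        using t by (intro bexI[of _ "t k"]) simp_all
    qed
    ultimately show "z \<in> {z \<in> cspace k. thick c (slice k K z)}" by simp
  qed
  ultimately show ?thesis by metis
qed

text \<open>Two moves lead from \<open>K\<close> to \<open>t\<close>. Over a base point with thick
  slice, the one-variable estimate carries the last coordinate to \<open>t k\<close>; then the
  inequality in \<open>k\<close> variables carries the base point to that of \<open>t\<close>. The
  constants multiply.\<close>

lemma bernstein_walsh_Suc:
  assumes K: "compact K" "K \<subseteq> cspace (Suc k)" and c: "0 < c"
    and bw: "bernstein_walsh k {z \<in> cspace k. thick c (slice k K z)}"
  shows "bernstein_walsh (Suc k) K"
  unfolding bernstein_walsh_def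
proof
  fix t assume t: "t \<in> cspace (Suc k)"
  define z where "z = t(k := undefined)"
  have z: "z \<in> cspace k" unfolding z_def by (rule cspace_Suc_restrict[OF t])
  have tz: "t = z(k := t k)" by (simp add: z_def)
  have "bounded ((\<lambda>t. t k) ` K)"
    by (intro compact_imp_bounded compact_continuous_image K continuous_on_coordinate)
  then obtain R where R: "0 < R" "\<forall>x\<in>(\<lambda>t. t k) ` K. cmod x \<le> R" unfolding bounded_pos by blast
  have sl: "slice k K z \<subseteq> cball 0 R" for z
  proof
    fix w assume "w \<in> slice k K z"
    then have "w \<in> (\<lambda>t. t k) ` K" unfolding slice_def by (intro image_eqI[of _ _ "z(k := w)"]) simp_all
    then show "w \<in> cball 0 R" using R(2) by auto
  qed
  \<comment> \<open>One \<open>C\<close> serves all slices, as they share the thickness constant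
    \<open>c\<close> and the radius \<open>R\<close>.\<close>
  obtain C where C: "C \<ge> 1"
    "\<And>S q D M u. thick c S \<Longrightarrow> S \<subseteq> cball 0 R \<Longrightarrow> degree q \<le> D \<Longrightarrow>
       (\<And>w. w \<in> S \<Longrightarrow> cmod (poly q w) \<le> M) \<Longrightarrow> cmod u \<le> cmod (t k) \<Longrightarrow> cmod (poly q u) \<le> C ^ D * M"
    using thick_poly_growth[OF c less_imp_le[OF R(1)] norm_ge_zero[of "t k"]] by metis
  obtain C' where C': "C' \<ge> 1"
    "\<And>D M P. separately_poly k D P \<Longrightarrow> (\<forall>s\<in>{z \<in> cspace k. thick c (slice k K z)}. cmod (P s) \<le> M) \<Longrightarrow>
       cmod (P z) \<le> C' ^ D * M"
    using bspec[OF bw[unfolded bernstein_walsh_def] z] by blast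
  show "\<exists>C\<ge>1. \<forall>D M P. separately_poly (Suc k) D P \<longrightarrow> (\<forall>s\<in>K. cmod (P s) \<le> M) \<longrightarrow> cmod (P t) \<le> C ^ D * M"
  proof (intro exI[of _ "C' * C"] conjI allI impI)
    show "1 \<le> C' * C" using C(1) C'(1) mult_mono[of 1 C' 1 C] by simp
    fix D M P assume P: "separately_poly (Suc k) D P" and bd: "\<forall>s\<in>K. cmod (P s) \<le> M"
    define Q where "Q s = P (s(k := t k))" for s
    have "separately_poly k D Q"
      unfolding separately_poly_def
    proof (intro ballI allI impI)
      fix s j assume s: "s \<in> cspace k" and j: "j < k"
      obtain q where "degree q \<le> D" "\<And>w. P ((s(k := t k))(j := w)) = poly q w"
        using P cspace_Suc_upd[OF s, of "t k"] less_SucI[OF j] unfolding separately_poly_def by blast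
      moreover have "(s(j := w))(k := t k) = (s(k := t k))(j := w)" for w using j by (intro fun_upd_twist) simp
      ultimately show "\<exists>q. degree q \<le> D \<and> (\<forall>w. Q (s(j := w)) = poly q w)"
        unfolding Q_def by auto
    qed
    moreover have "cmod (Q s) \<le> C ^ D * M" if s: "s \<in> cspace k" and th: "thick c (slice k K s)" for s
    proof -
      obtain q where q: "degree q \<le> D" "\<And>w. P ((s(k := t k))(k := w)) = poly q w"
        using P cspace_Suc_upd[OF s, of "t k"] lessI[of k] unfolding separately_poly_def by blast
      then have q': "P (s(k := w)) = poly q w" for w by simp
      have "cmod (poly q (t k)) \<le> C ^ D * M"
        by (rule C(2)[OF th sl q(1)]) (use bd in \<open>auto simp: q'[symmetric] slice_def\<close>)
      then show ?thesis by (simp add: Q_def q')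
    qed
    ultimately have "cmod (Q z) \<le> C' ^ D * (C ^ D * M)" by (intro C'(2)) auto
    then show "cmod (P t) \<le> (C' * C) ^ D * M"
      unfolding Q_def by (subst tz) (simp add: power_mult_distrib mult.assoc)
  qed
qed

text \<open>The family of compact sets is refined at each reduction of the dimension. A slice of
  \<open>E\<close> of positive capacity is covered by the slices of the members of the family, so
  one of these is thick; hence the compact sets of base points with thick slices cover the next
  \<open>Gamma_step\<close>. The induction selects one of them, and
  \<open>bernstein_walsh_Suc\<close> climbs back up.\<close>

lemma bernstein_walsh_of_Gamma1:
  assumes "log_capacity (Gamma1 m E) > 0" "countable \<K>" "E \<subseteq> \<Union>\<K>"
    "\<And>K. K \<in> \<K> \<Longrightarrow> compact K \<and> K \<subseteq> cspace m"
  shows "\<exists>K\<in>\<K>. bernstein_walsh m K"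
  using assms
proof (induction m E arbitrary: \<K> rule: Gamma1.induct)
  case (1 E)
  \<comment> \<open>Positive capacity of the empty set is refuted by covering it with the empty
    family.\<close>
  obtain S n where "S \<in> ({} :: complex set set)" "thick (1 / real (Suc n)) S"
    by (rule thick_of_capacity[of "{}" "{}"]) (use 1 in auto)
  then show ?case by simp
next
  case (2 E)
  \<comment> \<open>The unique point of \<open>cspace 0\<close>. Over it, a set in one complex
    variable is a single slice.\<close>
  define u :: "nat \<Rightarrow> complex" where "u = (\<lambda>_. undefined)"
  have u: "(\<lambda>i\<in>{..<1::nat}. w) = u(0 := w)" for w by (auto simp: u_def)
  have c0: "cspace 0 = {u}" by (auto simp: cspace_def u_def)
  have "Gamma1 (Suc 0) E \<subseteq> (\<Union>K\<in>\<K>. slice 0 K u)"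
    using 2(3) unfolding Gamma1.simps slice_def u by blast
  moreover have "countable ((\<lambda>K. slice 0 K u) ` \<K>)" using 2(2) by simp
  moreover have "closed S" if "S \<in> (\<lambda>K. slice 0 K u) ` \<K>" for S
    using that 2(4) compact_slice by (auto intro: compact_imp_closed)
  ultimately obtain S n where S: "S \<in> (\<lambda>K. slice 0 K u) ` \<K>" "thick (1 / real (Suc n)) S"
    using thick_of_capacity[OF 2(1), of "(\<lambda>K. slice 0 K u) ` \<K>"] by blast
  then obtain K where K: "K \<in> \<K>" "thick (1 / real (Suc n)) (slice 0 K u)" by blast
  have "{z \<in> cspace 0. thick (1 / real (Suc n)) (slice 0 K z)} = cspace 0"
    using K(2) by (auto simp: c0)
  then have "bernstein_walsh 0 {z \<in> cspace 0. thick (1 / real (Suc n)) (slice 0 K z)}"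
    using bernstein_walsh_0 by simp
  then have "bernstein_walsh (Suc 0) K"
    by (rule bernstein_walsh_Suc[rotated 3]) (use 2(4)[OF K(1)] in auto)
  then show ?case using K(1) by blast
next
  case (3 k E)
  define T where "T K n = {z \<in> cspace (Suc k). thick (1 / real (Suc n)) (slice (Suc k) K z)}" for K n
  have step: "Gamma_step (Suc k) E \<subseteq> (\<Union>K\<in>\<K>. \<Union>n. T K n)"
  proof
    fix z assume z: "z \<in> Gamma_step (Suc k) E"
    then have cap: "log_capacity {w. z(Suc k := w) \<in> E} > 0" and zc: "z \<in> cspace (Suc k)"
      unfolding Gamma_step_def by auto
    have "{w. z(Suc k := w) \<in> E} \<subseteq> \<Union>((\<lambda>K. slice (Suc k) K z) ` \<K>)"
      using 3(4) unfolding slice_def by blast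
    moreover have "countable ((\<lambda>K. slice (Suc k) K z) ` \<K>)" using 3(3) by simp
    moreover have "closed S" if "S \<in> (\<lambda>K. slice (Suc k) K z) ` \<K>" for S
      using that 3(5) compact_slice by (auto intro: compact_imp_closed)
    ultimately obtain S n where "S \<in> (\<lambda>K. slice (Suc k) K z) ` \<K>" "thick (1 / real (Suc n)) S"
      using thick_of_capacity[OF cap, of "(\<lambda>K. slice (Suc k) K z) ` \<K>"] by blast
    then show "z \<in> (\<Union>K\<in>\<K>. \<Union>n. T K n)" using zc unfolding T_def by blast
  qed
  have "\<exists>K'\<in>(\<lambda>(K, n). T K n) ` (\<K> \<times> UNIV). bernstein_walsh (Suc k) K'"
  proof (rule 3(1))
    show "0 < log_capacity (Gamma1 (Suc k) (Gamma_step (Suc k) E))" using 3(2) by simp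
    show "countable ((\<lambda>(K, n). T K n) ` (\<K> \<times> (UNIV :: nat set)))" using 3(3) by auto
    show "Gamma_step (Suc k) E \<subseteq> \<Union> ((\<lambda>(K, n). T K n) ` (\<K> \<times> UNIV))" using step by auto
    fix K' assume "K' \<in> (\<lambda>(K, n). T K n) ` (\<K> \<times> UNIV)"
    then show "compact K' \<and> K' \<subseteq> cspace (Suc k)"
      using compact_thick_slices 3(5) unfolding T_def by auto
  qed
  then obtain K n where K: "K \<in> \<K>" "bernstein_walsh (Suc k) (T K n)" by auto
  have "bernstein_walsh (Suc (Suc k)) K"
    by (rule bernstein_walsh_Suc[OF _ _ _ K(2)[unfolded T_def]]) (use 3(5)[OF K(1)] in auto)
  then show ?case using K(1) by blast
qed

section \<open>Unitary changes of coordinates and polynomials in the parameter\<close>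

definition adjoint_matrix :: "(nat \<Rightarrow> nat \<Rightarrow> complex) \<Rightarrow> nat \<Rightarrow> nat \<Rightarrow> complex" where
  "adjoint_matrix U i j = cnj (U j i)"

text \<open>
  The rows of \<open>U\<close> being orthonormal, so are its columns: with \<open>W = U\<^sup>* U\<close>, the sum of the
  \<open>\<bar>W j l - \<delta>\<^sub>j\<^sub>l\<bar>\<^sup>2\<close> expands to \<open>m - 2 m + m\<close>.
\<close>
lemma unitary_columns:
  assumes U: "U \<in> unitary_matrices m" and "j < m" "l < m"
  shows "(\<Sum>i<m. cnj (U i j) * U i l) = (if j = l then 1 else 0)"
proof -
  define W where "W j l = (\<Sum>i<m. cnj (U i j) * U i l)" for j l
  define \<delta> where "\<delta> j l = (if j = l then 1 else 0 :: complex)" for j l :: nat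
  have ortho: "(\<Sum>k<m. U i k * cnj (U j k)) = \<delta> i j" if "i < m" "j < m" for i j
    using U that unfolding unitary_matrices_def \<delta>_def by auto
  have tr: "(\<Sum>j<m. W j j) = of_nat m"
  proof -
    have "(\<Sum>j<m. W j j) = (\<Sum>i<m. \<Sum>j<m. U i j * cnj (U i j))"
      unfolding W_def by (subst sum.swap) (simp add: mult.commute)
    also have "\<dots> = (\<Sum>i<m. 1)" by (intro sum.cong) (auto simp: ortho \<delta>_def)
    finally show ?thesis by simp
  qed
  have cW: "cnj (W j l) = W l j" for j l unfolding W_def by (simp add: mult.commute)
  have c\<delta>: "cnj (\<delta> j l) = \<delta> j l" for j l unfolding \<delta>_def by simp
  have WW: "(\<Sum>l<m. W j l * W l j') = W j j'" for j j'
  proof -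
    have "(\<Sum>l<m. W j l * W l j') = (\<Sum>l<m. \<Sum>i<m. \<Sum>i'<m. cnj (U i j) * U i' j' * (U i l * cnj (U i' l)))"
      unfolding W_def sum_product by (intro sum.cong refl) (simp add: algebra_simps)
    also have "\<dots> = (\<Sum>i<m. \<Sum>l<m. \<Sum>i'<m. cnj (U i j) * U i' j' * (U i l * cnj (U i' l)))"
      by (rule sum.swap)
    also have "\<dots> = (\<Sum>i<m. \<Sum>i'<m. \<Sum>l<m. cnj (U i j) * U i' j' * (U i l * cnj (U i' l)))"
      by (intro sum.cong refl sum.swap)
    also have "\<dots> = (\<Sum>i<m. \<Sum>i'<m. cnj (U i j) * U i' j' * \<delta> i i')"
      by (intro sum.cong refl) (simp add: ortho flip: sum_distrib_left)
    also have "\<dots> = W j j'" unfolding W_def \<delta>_def by (simp add: if_distrib sum.delta cong: if_cong)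
    finally show ?thesis .
  qed
  have "(\<Sum>j<m. \<Sum>l<m. (W j l - \<delta> j l) * cnj (W j l - \<delta> j l)) =
      (\<Sum>j<m. (\<Sum>l<m. W j l * W l j) - (\<Sum>l<m. W j l * \<delta> j l) - (\<Sum>l<m. \<delta> j l * W l j) + (\<Sum>l<m. \<delta> j l * \<delta> j l))"
    by (intro sum.cong refl) (simp add: cW c\<delta> algebra_simps sum.distrib sum_subtractf)
  also have "\<dots> = (\<Sum>j<m. W j j - W j j - W j j + 1)"
    by (intro sum.cong refl) (simp add: WW \<delta>_def if_distrib[of "\<lambda>x. _ * x"] if_distrib[of "\<lambda>x. x * _"] cong: if_cong)
  also have "\<dots> = 0" using tr by (simp add: sum_subtractf)
  finally have "(\<Sum>j<m. \<Sum>l<m. (W j l - \<delta> j l) * cnj (W j l - \<delta> j l)) = 0" .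
  then have "complex_of_real (\<Sum>j<m. \<Sum>l<m. (cmod (W j l - \<delta> j l))\<^sup>2) = 0"
    by (simp only: complex_norm_square of_real_sum)
  then have "(\<Sum>j<m. \<Sum>l<m. (cmod (W j l - \<delta> j l))\<^sup>2) = 0" by (simp only: of_real_eq_0_iff)
  then have "\<forall>j\<in>{..<m}. (\<Sum>l<m. (cmod (W j l - \<delta> j l))\<^sup>2) = 0"
    by (subst (asm) sum_nonneg_eq_0_iff) (auto intro: sum_nonneg)
  then have "(\<Sum>l<m. (cmod (W j l - \<delta> j l))\<^sup>2) = 0" using \<open>j < m\<close> by blast
  then have "\<forall>l\<in>{..<m}. (cmod (W j l - \<delta> j l))\<^sup>2 = 0"
    by (subst (asm) sum_nonneg_eq_0_iff) auto
  then have "W j l = \<delta> j l" using \<open>l < m\<close> by auto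
  then show ?thesis unfolding W_def \<delta>_def .
qed

lemma apply_matrix_cspace: "apply_matrix m U t \<in> cspace m"
  unfolding apply_matrix_def cspace_def by auto

lemma apply_adjoint_matrix:
  assumes U: "U \<in> unitary_matrices m" and t: "t \<in> cspace m"
  shows "apply_matrix m (adjoint_matrix U) (apply_matrix m U t) = t"
proof
  fix j
  show "apply_matrix m (adjoint_matrix U) (apply_matrix m U t) j = t j"
  proof (cases "j < m")
    case True
    have "apply_matrix m (adjoint_matrix U) (apply_matrix m U t) j = (\<Sum>i<m. \<Sum>l<m. cnj (U i j) * U i l * t l)"
      using True unfolding apply_matrix_def adjoint_matrix_def by (simp add: sum_distrib_left mult.assoc)
    also have "\<dots> = (\<Sum>l<m. (\<Sum>i<m. cnj (U i j) * U i l) * t l)"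
      unfolding sum_distrib_right by (rule sum.swap)
    also have "\<dots> = (\<Sum>l<m. (if j = l then 1 else 0) * t l)"
      using True by (intro sum.cong) (auto simp: unitary_columns[OF U])
    also have "\<dots> = t j" using True by (simp add: if_distrib[of "\<lambda>x. x * _"] cong: if_cong)
    finally show ?thesis .
  next
    case False
    then show ?thesis using t unfolding apply_matrix_def cspace_def by (auto simp: PiE_iff extensional_def)
  qed
qed

lemma continuous_on_apply_matrix: "continuous_on S (apply_matrix m U)"
proof (rule continuous_on_coordinatewise_then_product)
  fix i show "continuous_on S (\<lambda>t. apply_matrix m U t i)"
    unfolding apply_matrix_def
    by (cases "i < m") (auto intro!: continuous_intros continuous_on_coordinate)
qed

text \<open>Along a coordinate line every entry of \<open>apply_matrix m V\<close> is affine, so a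
  monomial of total degree e becomes a polynomial in \<open>w\<close> of degree at most e. A bound
  on the total degree therefore survives any linear change of coordinates.\<close>

lemma polynomial_of_degree_less_separately_poly:
  assumes P: "polynomial_of_degree_less m B P" and D: "B \<le> real D"
  shows "separately_poly m D (\<lambda>s. P (apply_matrix m V s))"
  unfolding separately_poly_def
proof (intro ballI allI impI)
  fix t j assume "t \<in> cspace m" "j < m"
  obtain c where c: "\<And>t. t \<in> cspace m \<Longrightarrow>
      P t = (\<Sum>i | i \<in> mindices m \<and> real (\<Sum>j<m. i j) < B. c i * tpow m t i)"
    using P unfolding polynomial_of_degree_less_def by blast
  define l where "l k = [:\<Sum>i\<in>{..<m} - {j}. V k i * t i, V k j:]" for k
  have lin: "apply_matrix m V (t(j := w)) k = poly (l k) w" if "k < m" for k w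
    using that \<open>j < m\<close> unfolding apply_matrix_def l_def
    by (simp add: sum.remove[of "{..<m}" j] algebra_simps)
  define q where "q = (\<Sum>i | i \<in> mindices m \<and> real (\<Sum>j<m. i j) < B. smult (c i) (\<Prod>k<m. l k ^ i k))"
  have "degree q \<le> D" unfolding q_def
  proof (intro degree_sum_le finite_mindices_less)
    fix i assume i: "i \<in> {i. i \<in> mindices m \<and> real (\<Sum>j<m. i j) < B}"
    have "degree (smult (c i) (\<Prod>k<m. l k ^ i k)) \<le> degree (\<Prod>k<m. l k ^ i k)" by (rule degree_smult_le)
    also have "\<dots> \<le> (\<Sum>k<m. degree (l k ^ i k))"
      using degree_prod_sum_le[of "{..<m}" "\<lambda>k. l k ^ i k"] by (simp add: o_def)
    also have "\<dots> \<le> (\<Sum>k<m. i k)"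
    proof (intro sum_mono)
      fix k
      have "degree (l k ^ i k) \<le> degree (l k) * i k" by (rule degree_power_le)
      also have "\<dots> \<le> 1 * i k" unfolding l_def by (intro mult_right_mono) (auto intro: degree_pCons_le[THEN order_trans])
      finally show "degree (l k ^ i k) \<le> i k" by simp
    qed
    also have "\<dots> \<le> D"
    proof -
      have "real (\<Sum>k<m. i k) < B" using i by blast
      then have "real (\<Sum>k<m. i k) \<le> real D" using D by linarith
      then show ?thesis by (simp only: of_nat_le_iff)
    qed
    finally show "degree (smult (c i) (\<Prod>k<m. l k ^ i k)) \<le> D" .
  qed
  moreover have "P (apply_matrix m V (t(j := w))) = poly q w" for w
    unfolding c[OF apply_matrix_cspace] q_def tpow_def
    by (simp add: poly_sum poly_prod poly_power flip: lin)
  ultimately show "\<exists>q. degree q \<le> D \<and> (\<forall>w. P (apply_matrix m V (t(j := w))) = poly q w)" by blast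
qed

lemma continuous_on_polynomial_of_degree_less:
  assumes "polynomial_of_degree_less m B P"
  shows "continuous_on (cspace m) P"
proof -
  obtain c where c: "\<And>t. t \<in> cspace m \<Longrightarrow>
      P t = (\<Sum>i | i \<in> mindices m \<and> real (\<Sum>j<m. i j) < B. c i * tpow m t i)"
    using assms unfolding polynomial_of_degree_less_def by blast
  have "continuous_on (cspace m) (\<lambda>t. \<Sum>i | i \<in> mindices m \<and> real (\<Sum>j<m. i j) < B. c i * tpow m t i)"
    unfolding tpow_def by (intro continuous_intros continuous_on_coordinate)
  then show ?thesis by (simp add: c cong: continuous_on_cong)
qed

text \<open>The singleton \<open>{undefined}\<close> at the indices from \<open>m\<close> on
  presents the polydisc as a full product of compact sets, to which Tychonoff's theorem
  applies.\<close>

lemma compact_polydisc: "compact {t \<in> cspace m. \<forall>j<m. cmod (t j) \<le> R}"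
proof -
  define X where "X i = (if i < m then cball 0 R else {undefined} :: complex set)" for i :: nat
  have "compactin (product_topology (\<lambda>_. euclidean) UNIV) (PiE UNIV X)"
    unfolding compactin_PiE by (auto simp: X_def)
  then have "compact (PiE UNIV X)" by (simp add: euclidean_product_topology)
  moreover have "PiE UNIV X = {t \<in> cspace m. \<forall>j<m. cmod (t j) \<le> R}"
    by (auto simp: X_def cspace_def PiE_iff extensional_def split: if_splits)
  ultimately show ?thesis by simp
qed

section \<open>Convergent power series in several variables\<close>

lemma norm_mmonom_le: "cmod (mmonom z k) \<le> norm z ^ mdeg k"
proof -
  have "cmod (mmonom z k) = (\<Prod>j\<in>UNIV. cmod (z $ j) ^ (k $ j))"
    unfolding mmonom_def by (simp add: norm_power prod_norm[symmetric])
  also have "\<dots> \<le> (\<Prod>j\<in>UNIV. norm z ^ (k $ j))"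
    by (intro prod_mono conjI power_mono) (auto intro: Finite_Cartesian_Product.norm_nth_le)
  also have "\<dots> = norm z ^ mdeg k" unfolding mdeg_def by (simp add: power_sum)
  finally show ?thesis .
qed

text \<open>A finite set of multi-indices lies in a cube, over which the sum factors into
  one-variable geometric sums, each at most 1/(1-x).\<close>

lemma summable_on_power_mdeg:
  fixes x :: real
  assumes "0 \<le> x" "x < 1"
  shows "(\<lambda>k::nat^'n. x ^ mdeg k) summable_on UNIV"
proof (rule nonneg_bdd_above_summable_on)
  show "bdd_above (sum (\<lambda>k::nat^'n. x ^ mdeg k) ` {F. F \<subseteq> UNIV \<and> finite F})"
  proof (rule bdd_aboveI2)
    fix F :: "(nat^'n) set" assume "F \<in> {F. F \<subseteq> UNIV \<and> finite F}"
    then have F: "finite F" by simp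
    define N where "N = (\<Sum>k\<in>F. mdeg k)"
    have sub: "F \<subseteq> vec_lambda ` (Pi\<^sub>E UNIV (\<lambda>_. {..N}))"
    proof
      fix k assume k: "k \<in> F"
      have "k $ j \<le> N" for j
      proof -
        have "k $ j \<le> mdeg k" unfolding mdeg_def by (rule member_le_sum) auto
        also have "\<dots> \<le> N" unfolding N_def using k F by (intro member_le_sum) auto
        finally show ?thesis .
      qed
      then have "vec_nth k \<in> Pi\<^sub>E UNIV (\<lambda>_. {..N})" by auto
      then show "k \<in> vec_lambda ` (Pi\<^sub>E UNIV (\<lambda>_. {..N}))" by (metis image_eqI vec_nth_inverse)
    qed
    have inj: "inj_on (vec_lambda :: ('n \<Rightarrow> nat) \<Rightarrow> nat^'n) X" for X
      by (rule inj_onI) (metis vec_lambda_inverse UNIV_I)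
    have "(\<Sum>k\<in>F. x ^ mdeg k) \<le> (\<Sum>k\<in>(vec_lambda ` (Pi\<^sub>E UNIV (\<lambda>_. {..N})) :: (nat^'n) set). x ^ mdeg k)"
      using assms by (intro sum_mono2 finite_imageI finite_PiE sub) auto
    also have "\<dots> = (\<Sum>g\<in>Pi\<^sub>E (UNIV :: 'n set) (\<lambda>_. {..N}). \<Prod>j\<in>UNIV. x ^ g j)"
      by (subst sum.reindex[OF inj]) (simp add: mdeg_def power_sum)
    also have "\<dots> = (\<Prod>j\<in>(UNIV :: 'n set). \<Sum>i\<le>N. x ^ i)"
      by (rule prod_sum_PiE[symmetric]) auto
    also have "\<dots> \<le> (\<Prod>j\<in>(UNIV :: 'n set). 1 / (1 - x))"
    proof (intro prod_mono conjI)
      show "(\<Sum>i\<le>N. x ^ i) \<le> 1 / (1 - x)"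
        using sum_le_suminf[of "\<lambda>i. x ^ i" "{..N}"] assms suminf_geometric[of x] summable_geometric[of x] by simp
    qed (use assms in \<open>auto intro: sum_nonneg\<close>)
    finally show "(\<Sum>k\<in>F. x ^ mdeg k) \<le> (1 / (1 - x)) ^ CARD('n)" by simp
  qed
qed (use assms in simp)

text \<open>A quantitative form of convergence: Cauchy estimates with \<rho> the inverse of a
  radius. For fixed constants it is a closed condition on each coefficient, which is what makes the
  sets of parameters compact in the dichotomy.\<close>

definition mfps_bounded :: "real \<Rightarrow> real \<Rightarrow> ('p::finite \<Rightarrow> 'n::finite mfps) \<Rightarrow> bool" where
  "mfps_bounded B \<rho> F \<longleftrightarrow> 0 < \<rho> \<and> (\<forall>a k. cmod (mcoeff (F a) k) \<le> B * \<rho> ^ mdeg k)"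

lemma mfps_bounded_nonneg: "mfps_bounded B \<rho> F \<Longrightarrow> 0 \<le> B"
  unfolding mfps_bounded_def
proof (elim conjE)
  assume "\<forall>a k. cmod (mcoeff (F a) k) \<le> B * \<rho> ^ mdeg k"
  then have "cmod (mcoeff (F undefined) 0) \<le> B * \<rho> ^ mdeg (0 :: nat^'b)" by blast
  then show "0 \<le> B" by (simp add: mdeg_def order_trans[OF norm_ge_zero])
qed

text \<open>The radius 1/(4\<rho>), smaller than convergence requires, leaves room for the factor
  \<open>2 ^ mdeg k\<close> lost when differentiating.\<close>

lemma mfps_bounded_term:
  assumes F: "mfps_bounded B \<rho> F" and z: "norm z \<le> 1 / (4 * \<rho>)"
  shows "cmod (mcoeff (F a) k * mmonom z k) \<le> B * (1/4) ^ mdeg k"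
proof -
  have \<rho>: "0 < \<rho>" and le: "cmod (mcoeff (F a) k) \<le> B * \<rho> ^ mdeg k" using F unfolding mfps_bounded_def by auto
  have "cmod (mcoeff (F a) k * mmonom z k) \<le> (B * \<rho> ^ mdeg k) * (1 / (4 * \<rho>)) ^ mdeg k"
    unfolding norm_mult using le z by (intro mult_mono order_trans[OF norm_mmonom_le] power_mono order_trans[OF norm_ge_zero le]) auto
  also have "\<dots> = B * (1/4) ^ mdeg k" using \<rho> by (simp add: power_divide power_mult_distrib field_simps)
  finally show ?thesis .
qed

lemma mfps_bounded_abs_summable:
  assumes F: "mfps_bounded B \<rho> F" and z: "norm z \<le> 1 / (4 * \<rho>)"
  shows "(\<lambda>k. norm (mcoeff (F a) k * mmonom z k)) summable_on UNIV"
proof (rule Infinite_Sum.abs_summable_on_comparison_test)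
  show "(\<lambda>k::nat^'b. norm (B * (1/4 :: real) ^ mdeg k)) summable_on UNIV"
    using summable_on_power_mdeg[of "1/4"] mfps_bounded_nonneg[OF F]
    by (auto simp: abs_mult intro!: summable_on_cmult_right)
  show "norm (mcoeff (F a) k * mmonom z k) \<le> norm (B * (1/4 :: real) ^ mdeg k)" for k
    using mfps_bounded_term[OF F z, of a k] by simp
qed

lemma mfps_bounded_summable_at:
  assumes "mfps_bounded B \<rho> F" "norm z \<le> 1 / (4 * \<rho>)"
  shows "mfps_summable_at F z"
  unfolding mfps_summable_at_def 
  by (rule allI) (rule Infinite_Sum.abs_summable_summable[OF mfps_bounded_abs_summable[OF assms]])

lemma mfps_bounded_converges:
  assumes F: "mfps_bounded B \<rho> F"
  shows "mfps_converges F"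
  unfolding mfps_converges_def
proof (intro exI conjI ballI)
  show "0 \<in> ball (0 :: complex^'b) (1 / (4 * \<rho>))" using F unfolding mfps_bounded_def by simp
  show "mfps_summable_at F z" if "z \<in> ball 0 (1 / (4 * \<rho>))" for z
    using that by (intro mfps_bounded_summable_at[OF F]) simp
qed simp

text \<open>Summability at one point with all coordinates equal to a small \<open>r > 0\<close>
  suffices: monomials there are \<open>r ^ mdeg k\<close>, complex summability is absolute, and each
  term is at most the total sum.\<close>

lemma mfps_converges_bounded:
  fixes F :: "'p::finite \<Rightarrow> 'n::finite mfps"
  assumes "mfps_converges F"
  obtains B \<rho> where "mfps_bounded B \<rho> F"
proof -
  obtain U where U: "open U" "(0 :: complex^'n) \<in> U" "\<And>z. z \<in> U \<Longrightarrow> mfps_summable_at F z"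
    using assms unfolding mfps_converges_def by blast
  obtain e where e: "e > 0" "ball 0 e \<subseteq> U" using U openE by blast
  define r where "r = e / (2 * real CARD('n))"
  have r: "r > 0" using e by (simp add: r_def)
  define z :: "complex^'n" where "z = (\<chi> j. of_real r)"
  have "norm z \<le> (\<Sum>j\<in>(UNIV :: 'n set). norm (z $ j))" unfolding norm_vec_def by (rule L2_set_le_sum) simp
  also have "\<dots> = e / 2"
  proof -
    have "norm (z $ j) = r" for j using r by (simp add: z_def)
    then show ?thesis by (simp add: r_def)
  qed
  finally have "z \<in> U" using e by auto
  then have "(\<lambda>k. norm (mcoeff (F a) k * mmonom z k)) summable_on UNIV" for a
    using U(3) unfolding mfps_summable_at_def summable_on_iff_abs_summable_on_complex by blast
  then have bd: "norm (mcoeff (F a) k * mmonom z k) \<le> (\<Sum>\<^sub>\<infinity>k. norm (mcoeff (F a) k * mmonom z k))" for a k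
    using finite_sum_le_infsum[of "\<lambda>k. norm (mcoeff (F a) k * mmonom z k)" UNIV "{k}"] by simp
  define B where "B = (\<Sum>a\<in>UNIV. \<Sum>\<^sub>\<infinity>k. norm (mcoeff (F a) k * mmonom z k))"
  have zk: "mmonom z k = of_real (r ^ mdeg k)" for k
    unfolding mmonom_def z_def mdeg_def by (simp add: power_sum)
  have "cmod (mcoeff (F a) k) \<le> B * (1 / r) ^ mdeg k" for a k
  proof -
    have "cmod (mcoeff (F a) k) * r ^ mdeg k = norm (mcoeff (F a) k * mmonom z k)"
      unfolding zk norm_mult using r by (simp add: norm_power)
    also have "\<dots> \<le> (\<Sum>\<^sub>\<infinity>k. norm (mcoeff (F a) k * mmonom z k))" by (rule bd)
    also have "\<dots> \<le> B" unfolding B_def by (rule member_le_sum) (auto intro: infsum_nonneg)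
    finally show ?thesis using r by (simp add: power_divide field_simps)
  qed
  then have "mfps_bounded B (1 / r) F" unfolding mfps_bounded_def using r by simp
  then show thesis by (rule that)
qed

section \<open>Termwise differentiation of power series\<close>

definition dmonom :: "'n \<Rightarrow> complex^'n \<Rightarrow> nat^'n \<Rightarrow> complex" where
  "dmonom j z k = of_nat (k $ j) * (z $ j) ^ (k $ j - 1) * (\<Prod>i\<in>UNIV - {j}. (z $ i) ^ (k $ i))"

text \<open>The truncated exponent \<open>k $ j - 1\<close> is harmless: for
  \<open>k $ j = 0\<close> the factor in front of it vanishes.\<close>

lemma has_derivative_mmonom:
  "((\<lambda>z. mmonom z k) has_derivative (\<lambda>h. \<Sum>j\<in>UNIV. dmonom j z k * h $ j)) (at z within S)"
proof -
  have "((\<lambda>z. \<Prod>j\<in>UNIV. (z $ j) ^ (k $ j)) has_derivative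
     (\<lambda>h. \<Sum>j\<in>UNIV. (of_nat (k $ j) * h $ j * (z $ j) ^ (k $ j - 1)) * (\<Prod>i\<in>UNIV - {j}. (z $ i) ^ (k $ i))))
     (at z within S)"
    by (intro has_derivative_prod has_derivative_power bounded_linear.has_derivative[OF bounded_linear_vec_nth]
        has_derivative_ident)
  then show ?thesis unfolding mmonom_def dmonom_def by (simp add: mult_ac)
qed

text \<open>The factor \<open>k $ j\<close> produced by differentiation is at most
  \<open>2 ^ mdeg k\<close>, which is absorbed by doubling \<open>r\<close>.\<close>

lemma norm_dmonom_le:
  assumes z: "norm z \<le> r" and r: "0 < r"
  shows "cmod (dmonom j z k) \<le> 1 / r * (2 * r) ^ mdeg k"
proof (cases "k $ j = 0")
  case False
  have "cmod (dmonom j z k) = of_nat (k $ j) * cmod (z $ j) ^ (k $ j - 1) * (\<Prod>i\<in>UNIV - {j}. cmod (z $ i) ^ (k $ i))"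
    unfolding dmonom_def by (simp add: norm_mult norm_power prod_norm[symmetric])
  also have "\<dots> \<le> of_nat (k $ j) * r ^ (k $ j - 1) * (\<Prod>i\<in>UNIV - {j}. r ^ (k $ i))"
    using z r
    by (intro mult_mono prod_mono conjI power_mono mult_nonneg_nonneg prod_nonneg)
      (auto intro: order_trans[OF Finite_Cartesian_Product.norm_nth_le])
  also have "\<dots> = of_nat (k $ j) / r * (r ^ (k $ j) * (\<Prod>i\<in>UNIV - {j}. r ^ (k $ i)))"
    using False r by (simp add: power_eq_if)
  also have "r ^ (k $ j) * (\<Prod>i\<in>UNIV - {j}. r ^ (k $ i)) = r ^ mdeg k"
    unfolding mdeg_def power_sum by (rule prod.remove[symmetric]) auto
  also have "of_nat (k $ j) / r * r ^ mdeg k \<le> 2 ^ mdeg k / r * r ^ mdeg k"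
  proof -
    have "k $ j \<le> mdeg k" unfolding mdeg_def by (rule member_le_sum) auto
    also have "\<dots> \<le> 2 ^ mdeg k" by (simp add: less_imp_le)
    finally have "real (k $ j) \<le> 2 ^ mdeg k" by (simp flip: of_nat_le_iff)
    then show ?thesis using r by (intro mult_right_mono divide_right_mono) auto
  qed
  also have "\<dots> = 1 / r * (2 * r) ^ mdeg k" by (simp add: power_mult_distrib)
  finally show ?thesis .
qed (use r in \<open>simp add: dmonom_def\<close>)

lemma dmonom_0:
  fixes j :: "'n::finite"
  shows "dmonom j 0 k = (if k = axis j 1 then 1 else 0)"
proof (cases "k = axis j 1")
  case True
  then show ?thesis by (simp add: dmonom_def axis_def)
next
  case False
  then obtain i where i: "k $ i \<noteq> axis j 1 $ i" by (auto simp: vec_eq_iff)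
  show ?thesis
  proof (cases "i = j")
    case True
    then have "k $ j \<noteq> 1" using i by (simp add: axis_def)
    then have "k $ j = 0 \<or> k $ j - 1 > 0" by linarith
    then show ?thesis using False by (auto simp: dmonom_def)
  next
    case F: False
    then have "k $ i \<noteq> 0" using i by (simp add: axis_def)
    then have "(\<Prod>i\<in>UNIV - {j}. ((0 :: complex^'n) $ i) ^ (k $ i)) = 0"
      using F by (intro prod_zero) auto
    then show ?thesis using False by (simp add: dmonom_def)
  qed
qed

lemma infinite_multi_indices: "infinite (UNIV :: (nat^'n) set)"
proof (rule infinite_super[OF subset_UNIV])
  show "infinite (range (\<lambda>m::nat. (\<chi> i. m) :: nat^'n))"
    by (rule range_inj_infinite) (simp add: inj_def vec_eq_iff)
qed

lemma mfps_eval_0: "mfps_eval F 0 $ a = mcoeff (F a) 0"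
proof -
  have 0: "mmonom 0 k = (if k = 0 then 1 else 0)" for k :: "nat^'b"
  proof (cases "k = 0")
    case False
    then obtain j where "k $ j \<noteq> 0" by (auto simp: vec_eq_iff)
    then show ?thesis using False unfolding mmonom_def by (auto intro!: prod_zero)
  qed (simp add: mmonom_def)
  have "(\<Sum>\<^sub>\<infinity>k. mcoeff (F a) k * mmonom 0 k) = (\<Sum>\<^sub>\<infinity>k\<in>{0}. mcoeff (F a) k * mmonom 0 k)"
    by (rule infsum_cong_neutral) (auto simp: 0)
  then show ?thesis unfolding mfps_eval_def by (simp add: 0)
qed

text \<open>Enumerating the multi-indices turns the unordered sum into an ordinary series, to which
  the Weierstrass test and termwise differentiation apply. Continuity of \<open>J\<close> is wanted
  for the inverse function theorem and for the openness of the rank condition.\<close>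

lemma mfps_eval_C1:
  fixes F :: "'p::finite \<Rightarrow> 'n::finite mfps"
  assumes F: "mfps_bounded B \<rho> F"
  obtains J :: "complex^'n \<Rightarrow> complex^'n^'p" where
    "\<And>z. z \<in> ball 0 (1 / (4 * \<rho>)) \<Longrightarrow> (mfps_eval F has_derivative (*v) (J z)) (at z)"
    "continuous_on (ball 0 (1 / (4 * \<rho>))) J" "J 0 = mfps_linear_part F"
proof -
  define r where "r = 1 / (4 * \<rho>)"
  have \<rho>: "0 < \<rho>" and cle: "cmod (mcoeff (F a) k) \<le> B * \<rho> ^ mdeg k" for a k
    using F unfolding mfps_bounded_def by auto
  have r: "r > 0" using \<rho> by (simp add: r_def)
  define S where "S = ball (0 :: complex^'n) r"
  define e where "e = from_nat_into (UNIV :: (nat^'n) set)"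
  have e: "bij_betw e UNIV UNIV"
    unfolding e_def by (intro bij_betw_from_nat_into infinite_multi_indices) simp
  define t where "t a j n z = mcoeff (F a) (e n) * dmonom j z (e n)" for a j n z
  \<comment> \<open>The derivative bound at \<open>r = 1 / (4 * \<rho>)\<close> turns
    \<open>\<rho> ^ mdeg k\<close> into powers of 1/2.\<close>
  define M where "M n = B / r * (1/2) ^ mdeg (e n)" for n
  define D where "D a j z = (\<Sum>n. t a j n z)" for a j z
  have M: "summable M"
  proof -
    have "(\<lambda>k::nat^'n. (1/2 :: real) ^ mdeg k) summable_on UNIV" by (rule summable_on_power_mdeg) auto
    then have "(\<lambda>n. (1/2 :: real) ^ mdeg (e n)) summable_on UNIV"
      using summable_on_reindex_bij_betw[OF e, of "\<lambda>k. (1/2 :: real) ^ mdeg k"] by simp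
    then have "summable (\<lambda>n. (1/2 :: real) ^ mdeg (e n))" by (rule summable_on_imp_summable)
    then show ?thesis unfolding M_def by (rule summable_mult)
  qed
  have tM: "cmod (t a j n z) \<le> M n" if z: "z \<in> S" for a j n z
  proof -
    have "cmod (t a j n z) \<le> (B * \<rho> ^ mdeg (e n)) * (1 / r * (2 * r) ^ mdeg (e n))"
      unfolding t_def norm_mult using z r
      by (intro mult_mono cle norm_dmonom_le order_trans[OF norm_ge_zero cle]) (auto simp: S_def)
    also have "\<dots> = M n" using \<rho> unfolding M_def r_def by (simp add: power_divide power_mult_distrib field_simps)
    finally show ?thesis .
  qed
  have unif: "uniform_limit S (\<lambda>n z. \<Sum>i<n. t a j i z) (D a j) sequentially" for a j
    unfolding D_def by (rule Weierstrass_m_test[OF tM M])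
  have contD: "continuous_on S (D a j)" for a j
  proof (rule uniform_limit_theorem[OF _ unif])
    show "\<forall>\<^sub>F n in sequentially. continuous_on S (\<lambda>z. \<Sum>i<n. t a j i z)"
      unfolding t_def dmonom_def by (intro always_eventually allI continuous_intros)
  qed simp
  have sums: "(\<lambda>n. mcoeff (F a) (e n) * mmonom z (e n)) sums (mfps_eval F z $ a)" if z: "z \<in> S" for a z
  proof -
    have "(\<lambda>k. mcoeff (F a) k * mmonom z k) summable_on UNIV"
      using mfps_bounded_summable_at[OF F, of z] z unfolding mfps_summable_at_def S_def r_def by auto
    then have "((\<lambda>k. mcoeff (F a) k * mmonom z k) has_sum (mfps_eval F z $ a)) UNIV"
      unfolding mfps_eval_def by simp
    then have "((\<lambda>n. mcoeff (F a) (e n) * mmonom z (e n)) has_sum (mfps_eval F z $ a)) UNIV"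
      using has_sum_reindex_bij_betw[OF e, of "\<lambda>k. mcoeff (F a) k * mmonom z k"] by simp
    then show ?thesis by (rule has_sum_imp_sums)
  qed
  have der: "((\<lambda>z. mfps_eval F z $ a) has_derivative (\<lambda>h. \<Sum>j\<in>UNIV. D a j z * h $ j)) (at z)" if z: "z \<in> S" for a z
  proof -
    have "\<exists>g. \<forall>x\<in>S. (\<lambda>n. mcoeff (F a) (e n) * mmonom x (e n)) sums (g x) \<and>
        (g has_derivative (\<lambda>h. \<Sum>j\<in>UNIV. D a j x * h $ j)) (at x within S)"
    proof (rule has_derivative_series[where f = "\<lambda>n x. mcoeff (F a) (e n) * mmonom x (e n)" and f' = "\<lambda>n x h. \<Sum>j\<in>UNIV. t a j n x * h $ j" and x = z and l = "mfps_eval F z $ a"])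
      show "convex S" unfolding S_def by simp
      show "((\<lambda>z. mcoeff (F a) (e n) * mmonom z (e n)) has_derivative
          (\<lambda>h. \<Sum>j\<in>UNIV. t a j n x * h $ j)) (at x within S)" for n x
        using has_derivative_mult_right[OF has_derivative_mmonom, of "mcoeff (F a) (e n)" "e n" x S]
        unfolding t_def by (simp add: sum_distrib_left mult.assoc)
      show "z \<in> S" "(\<lambda>n. mcoeff (F a) (e n) * mmonom z (e n)) sums (mfps_eval F z $ a)"
        using z sums by auto
      fix \<epsilon> :: real assume \<epsilon>: "\<epsilon> > 0"
      define \<epsilon>' where "\<epsilon>' = \<epsilon> / CARD('n)"
      have "\<epsilon>' > 0" using \<epsilon> by (simp add: \<epsilon>'_def)
      then have "\<forall>\<^sub>F n in sequentially. \<forall>j. \<forall>x\<in>S. dist (\<Sum>i<n. t a j i x) (D a j x) < \<epsilon>'"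
        by (intro eventually_all_finite uniform_limitD[OF unif])
      then show "\<forall>\<^sub>F n in sequentially. \<forall>x\<in>S. \<forall>h. norm ((\<Sum>i<n. \<Sum>j\<in>UNIV. t a j i x * h $ j) - (\<Sum>j\<in>UNIV. D a j x * h $ j)) \<le> \<epsilon> * norm h"
      proof eventually_elim
        case (elim n)
        show ?case
        proof (intro ballI allI)
          fix x :: "complex^'n" and h :: "complex^'n" assume x: "x \<in> S"
          have "(\<Sum>i<n. \<Sum>j\<in>UNIV. t a j i x * h $ j) - (\<Sum>j\<in>UNIV. D a j x * h $ j) =
              (\<Sum>j\<in>UNIV. ((\<Sum>i<n. t a j i x) - D a j x) * h $ j)"
            by (subst sum.swap) (simp add: sum_distrib_right left_diff_distrib sum_subtractf)
          also have "norm \<dots> \<le> (\<Sum>j\<in>(UNIV :: 'n set). \<epsilon>' * norm h)"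
          proof (rule sum_norm_le)
            fix j
            have "cmod ((\<Sum>i<n. t a j i x) - D a j x) \<le> \<epsilon>'"
              using elim x by (auto simp: dist_norm intro: less_imp_le)
            then show "norm (((\<Sum>i<n. t a j i x) - D a j x) * h $ j) \<le> \<epsilon>' * norm h"
              unfolding norm_mult using \<open>\<epsilon>' > 0\<close>
              by (intro mult_mono Finite_Cartesian_Product.norm_nth_le) auto
          qed
          also have "\<dots> = \<epsilon> * norm h" by (simp add: \<epsilon>'_def)
          finally show "norm ((\<Sum>i<n. \<Sum>j\<in>UNIV. t a j i x * h $ j) - (\<Sum>j\<in>UNIV. D a j x * h $ j)) \<le> \<epsilon> * norm h" .
        qed
      qed
    qed
    then obtain g where g: "\<And>x. x \<in> S \<Longrightarrow> (\<lambda>n. mcoeff (F a) (e n) * mmonom x (e n)) sums (g x)"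
        "(g has_derivative (\<lambda>h. \<Sum>j\<in>UNIV. D a j z * h $ j)) (at z within S)" using z by blast
    have eq: "mfps_eval F x $ a = g x" if "x \<in> S" for x
      using sums[OF that] g(1)[OF that] by (rule sums_unique2)
    have "((\<lambda>z. mfps_eval F z $ a) has_derivative (\<lambda>h. \<Sum>j\<in>UNIV. D a j z * h $ j)) (at z within S)"
      by (rule has_derivative_transform[OF z eq g(2)])
    moreover have "at z within S = at z" using z unfolding S_def by (intro at_within_open) auto
    ultimately show ?thesis by simp
  qed
  define J where "J z = (\<chi> a j. D a j z)" for z
  have "(mfps_eval F has_derivative (*v) (J z)) (at z)" if "z \<in> S" for z
    unfolding has_derivative_componentwise_within[of "mfps_eval F"]
  proof
    fix i :: "complex^'p" assume "i \<in> Basis"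
    then obtain a u where i: "i = axis a u" unfolding Basis_vec_def by blast
    show "((\<lambda>x. mfps_eval F x \<bullet> i) has_derivative (\<lambda>x. (J z *v x) \<bullet> i)) (at z)"
      using bounded_linear.has_derivative[OF bounded_linear_inner_left[of u] der[OF that, of a]]
      unfolding i inner_axis by (simp add: J_def matrix_vector_mult_def)
  qed
  moreover have "continuous_on S J"
    unfolding J_def by (intro continuous_on_vec_lambda contD)
  moreover have "J 0 = mfps_linear_part F"
  proof -
    have "D a j 0 = mcoeff (F a) (axis j 1)" for a j
    proof -
      obtain n where n: "e n = axis j 1" using e unfolding bij_betw_def by (metis UNIV_I imageE)
      have "D a j 0 = (\<Sum>m\<in>{n}. t a j m 0)"
        unfolding D_def
      proof (rule suminf_finite)
        fix m assume "m \<notin> {n}"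
        then have "e m \<noteq> axis j 1" using e n unfolding bij_betw_def inj_on_def by (metis UNIV_I singletonI)
        then show "t a j m 0 = 0" by (simp add: t_def dmonom_0)
      qed simp
      then show ?thesis by (simp add: t_def dmonom_0 n)
    qed
    then show ?thesis by (simp add: J_def mfps_linear_part_def)
  qed
  ultimately show thesis using that[of J] unfolding S_def r_def by blast
qed

section \<open>Jets\<close>

definition taylor :: "nat \<Rightarrow> 'n::finite mfps \<Rightarrow> complex^'n \<Rightarrow> complex" where
  "taylor N C z = (\<Sum>k | mdeg k \<le> N. mcoeff C k * mmonom z k)"

text \<open>Only the truncation of \<open>C\<close> enters, so \<open>C\<close> may diverge. This is
  what lets formal identities be read as estimates for functions.\<close>

definition has_jet :: "nat \<Rightarrow> (complex^'n \<Rightarrow> complex) \<Rightarrow> 'n::finite mfps \<Rightarrow> bool" where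
  "has_jet N \<phi> C \<longleftrightarrow> (\<exists>B. \<forall>\<^sub>F z in nhds 0. cmod (\<phi> z - taylor N C z) \<le> B * norm z ^ Suc N)"

definition big_power :: "nat \<Rightarrow> (complex^'n \<Rightarrow> complex) \<Rightarrow> bool" where
  "big_power N \<phi> \<longleftrightarrow> (\<exists>B. \<forall>\<^sub>F z in nhds 0. cmod (\<phi> z) \<le> B * norm z ^ N)"

lemma has_jet_iff: "has_jet N \<phi> C \<longleftrightarrow> big_power (Suc N) (\<lambda>z. \<phi> z - taylor N C z)"
  by (simp add: has_jet_def big_power_def)

lemma big_power_add:
  assumes "big_power N f" "big_power N g"
  shows "big_power N (\<lambda>z. f z + g z)"
proof -
  obtain B C where "\<forall>\<^sub>F z in nhds 0. cmod (f z) \<le> B * norm z ^ N" "\<forall>\<^sub>F z in nhds 0. cmod (g z) \<le> C * norm z ^ N"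
    using assms unfolding big_power_def by blast
  then have "\<forall>\<^sub>F z in nhds 0. cmod (f z + g z) \<le> (B + C) * norm z ^ N"
    by eventually_elim (auto simp: distrib_right intro: norm_triangle_le)
  then show ?thesis unfolding big_power_def by blast
qed

lemma big_power_mult:
  assumes "big_power M f" "big_power N g"
  shows "big_power (M + N) (\<lambda>z. f z * g z)"
proof -
  obtain B C where "\<forall>\<^sub>F z in nhds 0. cmod (f z) \<le> B * norm z ^ M" "\<forall>\<^sub>F z in nhds 0. cmod (g z) \<le> C * norm z ^ N"
    using assms unfolding big_power_def by blast
  then have "\<forall>\<^sub>F z in nhds 0. cmod (f z * g z) \<le> (B * C) * norm z ^ (M + N)"
  proof eventually_elim
    case (elim z)
    have "cmod (f z * g z) \<le> (B * norm z ^ M) * (C * norm z ^ N)"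
      unfolding norm_mult using elim by (intro mult_mono) (auto intro: order_trans[OF norm_ge_zero])
    then show ?case by (simp add: power_add mult_ac)
  qed
  then show ?thesis unfolding big_power_def by blast
qed

lemma big_power_const: "big_power 0 (\<lambda>z. c)"
  unfolding big_power_def by (intro exI[of _ "cmod c"]) simp

lemma big_power_cmult: "big_power N f \<Longrightarrow> big_power N (\<lambda>z. c * f z)"
  using big_power_mult[OF big_power_const, of N f c] by simp

lemma big_power_diff: "big_power N f \<Longrightarrow> big_power N g \<Longrightarrow> big_power N (\<lambda>z. f z - g z)"
  using big_power_add[of N f "\<lambda>z. (-1) * g z"] big_power_cmult[of N g "-1"] by simp

lemma big_power_0: "big_power N (\<lambda>z. 0)"
  unfolding big_power_def by (intro exI[of _ 0]) simp

lemma big_power_sum: "(\<And>i. i \<in> I \<Longrightarrow> big_power N (f i)) \<Longrightarrow> big_power N (\<lambda>z. \<Sum>i\<in>I. f i z)"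
  by (induction I rule: infinite_finite_induct) (auto intro: big_power_0 big_power_add)

lemma big_power_le:
  assumes "big_power M f" "N \<le> M"
  shows "big_power N f"
proof -
  obtain B where "\<forall>\<^sub>F z in nhds 0. cmod (f z) \<le> B * norm z ^ M"
    using assms unfolding big_power_def by blast
  moreover have "\<forall>\<^sub>F z in nhds (0 :: complex^'a). norm z < 1"
    using eventually_nhds_in_open[of "ball 0 1" "0 :: complex^'a"] by simp
  ultimately have "\<forall>\<^sub>F z in nhds 0. cmod (f z) \<le> \<bar>B\<bar> * norm z ^ N"
  proof eventually_elim
    case (elim z)
    have "cmod (f z) \<le> \<bar>B\<bar> * norm z ^ M"
      using elim(1) by (rule order_trans) (intro mult_right_mono, auto)
    also have "\<dots> \<le> \<bar>B\<bar> * norm z ^ N"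
      using elim(2) \<open>N \<le> M\<close> by (intro mult_left_mono power_decreasing) auto
    finally show ?case .
  qed
  then show ?thesis unfolding big_power_def by blast
qed

lemma big_power_mmonom: "big_power (mdeg k) (\<lambda>z. mmonom z k)"
  unfolding big_power_def by (intro exI[of _ 1]) (simp add: norm_mmonom_le)

lemma big_power_taylor: "big_power 0 (taylor N C)"
  unfolding taylor_def
  by (intro big_power_sum big_power_cmult big_power_le[OF big_power_mmonom]) simp

lemma has_jet_big_power:
  assumes "has_jet N \<phi> C"
  shows "big_power 0 \<phi>"
  using big_power_add[OF big_power_le[OF assms[unfolded has_jet_iff], of 0] big_power_taylor[of N C]] by simp

lemma mmonom_add: "mmonom z (i + j) = mmonom z i * mmonom z j"
  unfolding mmonom_def by (simp add: power_add prod.distrib)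

lemma mcoeff_mult: "mcoeff (a * b) k = (\<Sum>(i, j)\<in>msplits k. mcoeff a i * mcoeff b j)"
  by (simp add: times_mfps_def)

lemma mcoeff_add: "mcoeff (a + b) k = mcoeff a k + mcoeff b k"
  by (simp add: plus_mfps_def)

lemma mcoeff_zero: "mcoeff 0 k = 0"
  by (simp add: zero_mfps_def)

lemma mcoeff_one: "mcoeff 1 k = (if k = 0 then 1 else 0)"
  by (simp add: one_mfps_def)

lemma mcoeff_sum: "mcoeff (\<Sum>i\<in>I. f i) k = (\<Sum>i\<in>I. mcoeff (f i) k)"
  by (induction I rule: infinite_finite_induct) (auto simp: mcoeff_add mcoeff_zero)

lemma has_jet_add:
  assumes "has_jet N \<phi> C" "has_jet N \<psi> D"
  shows "has_jet N (\<lambda>z. \<phi> z + \<psi> z) (C + D)"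
proof -
  have "taylor N (C + D) z = taylor N C z + taylor N D z" for z
    by (simp add: taylor_def mcoeff_add distrib_right sum.distrib)
  then show ?thesis using big_power_add[OF assms[unfolded has_jet_iff]]
    unfolding has_jet_iff by (simp add: algebra_simps)
qed

lemma has_jet_zero: "has_jet N (\<lambda>z. 0) 0"
  unfolding has_jet_iff taylor_def by (simp add: mcoeff_zero big_power_0)

lemma has_jet_sum: "(\<And>i. i \<in> I \<Longrightarrow> has_jet N (f i) (C i)) \<Longrightarrow> has_jet N (\<lambda>z. \<Sum>i\<in>I. f i z) (\<Sum>i\<in>I. C i)"
  by (induction I rule: infinite_finite_induct) (auto intro: has_jet_zero has_jet_add)

text \<open>Pairs of total degree at most N lie in the square of indices of degree at most N, so
  they cancel. Only monomials of degree above N remain, which is the error a jet of order N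
  tolerates.\<close>

lemma taylor_mult:
  "taylor N C z * taylor N D z - taylor N (C * D) z =
     (\<Sum>(i, j) | mdeg i \<le> N \<and> mdeg j \<le> N \<and> mdeg (i + j) > N. mcoeff C i * mcoeff D j * mmonom z (i + j))"
proof -
  let ?f = "\<lambda>(i, j). mcoeff C i * mcoeff D j * mmonom z (i + j)"
  let ?A = "{k. mdeg k \<le> N} \<times> {k. mdeg k \<le> N} :: ((nat^'a) \<times> (nat^'a)) set"
  let ?L = "{(i, j). mdeg (i + j) \<le> N} :: ((nat^'a) \<times> (nat^'a)) set"
  have finA: "finite ?A" by (intro finite_cartesian_product finite_mdeg_le)
  have "taylor N C z * taylor N D z = (\<Sum>p\<in>?A. ?f p)"
    unfolding taylor_def sum_product sum.cartesian_product by (intro sum.cong) (auto simp: mmonom_add)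
  moreover have "taylor N (C * D) z = (\<Sum>p\<in>?L. ?f p)"
  proof -
    have "taylor N (C * D) z = (\<Sum>k | mdeg k \<le> N. \<Sum>p\<in>msplits k. ?f p)"
      unfolding taylor_def mcoeff_mult sum_distrib_right
      by (intro sum.cong) (auto simp: msplits_def)
    also have "\<dots> = (\<Sum>(k, p)\<in>(SIGMA k:{k. mdeg k \<le> N}. msplits k). ?f p)"
      by (rule sum.Sigma) (auto intro: finite_mdeg_le)
    also have "\<dots> = (\<Sum>p\<in>?L. ?f p)"
      by (rule sum.reindex_bij_witness[where i = "\<lambda>p. (fst p + snd p, p)" and j = snd]) (auto simp: msplits_def)
    finally show ?thesis .
  qed
  moreover have "?L \<subseteq> ?A" by (auto simp: mdeg_add)
  ultimately have "taylor N C z * taylor N D z - taylor N (C * D) z = (\<Sum>p\<in>?A - ?L. ?f p)"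
    using sum_diff[OF finA, of ?L ?f] by simp
  also have "?A - ?L = {(i, j). mdeg i \<le> N \<and> mdeg j \<le> N \<and> mdeg (i + j) > N}" by auto
  finally show ?thesis .
qed

text \<open>Write \<phi>\<psi> minus the truncation of \<open>C * D\<close> as (\<phi> - TC)\<psi> +
  TC(\<psi> - TD) + (TC TD - T(CD)), with T for \<open>taylor N\<close>. The factors \<psi> and TC
  are bounded near 0.\<close>

lemma has_jet_mult:
  assumes C: "has_jet N \<phi> C" and D: "has_jet N \<psi> D"
  shows "has_jet N (\<lambda>z. \<phi> z * \<psi> z) (C * D)"
proof -
  have "big_power (Suc N) (\<lambda>z. (\<phi> z - taylor N C z) * \<psi> z)"
    using big_power_mult[OF C[unfolded has_jet_iff] has_jet_big_power[OF D]] by simp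
  moreover have "big_power (Suc N) (\<lambda>z. taylor N C z * (\<psi> z - taylor N D z))"
    using big_power_mult[OF big_power_taylor D[unfolded has_jet_iff]] by simp
  moreover have "big_power (Suc N) (\<lambda>z. taylor N C z * taylor N D z - taylor N (C * D) z)"
    unfolding taylor_mult case_prod_unfold
    by (intro big_power_sum big_power_cmult big_power_le[OF big_power_mmonom]) auto
  ultimately have "big_power (Suc N) (\<lambda>z. ((\<phi> z - taylor N C z) * \<psi> z + taylor N C z * (\<psi> z - taylor N D z)) +
      (taylor N C z * taylor N D z - taylor N (C * D) z))"
    by (intro big_power_add)
  then show ?thesis unfolding has_jet_iff by (simp add: algebra_simps)
qed

lemma has_jet_one: "has_jet N (\<lambda>z. 1) 1"
proof -
  have "taylor N 1 z = 1" for z :: "complex^'a"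
  proof -
    have "taylor N 1 z = (\<Sum>k | mdeg k \<le> N. if k = 0 then mmonom z k else 0)"
      unfolding taylor_def by (intro sum.cong) (auto simp: mcoeff_one)
    also have "\<dots> = 1" by (subst sum.delta[OF finite_mdeg_le]) (simp add: mdeg_def mmonom_def)
    finally show ?thesis .
  qed
  then show ?thesis unfolding has_jet_iff by (simp add: big_power_0)
qed

lemma has_jet_power: "has_jet N \<phi> C \<Longrightarrow> has_jet N (\<lambda>z. \<phi> z ^ n) (C ^ n)"
  by (induction n) (auto intro: has_jet_one has_jet_mult)

lemma has_jet_prod: "(\<And>i. i \<in> I \<Longrightarrow> has_jet N (f i) (C i)) \<Longrightarrow> has_jet N (\<lambda>z. \<Prod>i\<in>I. f i z) (\<Prod>i\<in>I. C i)"
  by (induction I rule: infinite_finite_induct) (auto intro: has_jet_one has_jet_mult)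

definition mfps_scale :: "complex \<Rightarrow> 'n::finite mfps \<Rightarrow> 'n mfps" where
  "mfps_scale c C = Abs_mfps (\<lambda>k. c * mcoeff C k)"

lemma has_jet_scale:
  assumes "has_jet N \<phi> C"
  shows "has_jet N (\<lambda>z. c * \<phi> z) (mfps_scale c C)"
proof -
  have "taylor N (mfps_scale c C) z = c * taylor N C z" for z
    by (simp add: taylor_def mfps_scale_def sum_distrib_left mult.assoc)
  then show ?thesis using big_power_cmult[OF assms[unfolded has_jet_iff], of c]
    unfolding has_jet_iff by (simp add: algebra_simps)
qed

text \<open>A possibly divergent series is the jet of its own truncation, so formal cofactors can be
  replaced by polynomials.\<close>

lemma has_jet_taylor: "has_jet N (taylor N C) C"
  unfolding has_jet_iff by (simp add: big_power_0)

lemma has_jet_cong: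
  assumes "\<forall>\<^sub>F z in nhds 0. \<phi> z = \<psi> z" "has_jet N \<phi> C"
  shows "has_jet N \<psi> C"
proof -
  obtain B where "\<forall>\<^sub>F z in nhds 0. cmod (\<phi> z - taylor N C z) \<le> B * norm z ^ Suc N"
    using assms(2) unfolding has_jet_def by blast
  with assms(1) have "\<forall>\<^sub>F z in nhds 0. cmod (\<psi> z - taylor N C z) \<le> B * norm z ^ Suc N"
    by eventually_elim simp
  then show ?thesis unfolding has_jet_def by blast
qed

text \<open>Every term of the tail has degree at least N+1, so the factor (|z|/r)^(N+1) comes out of
  it. What remains is dominated by a convergent geometric sum \<open>S\<close> independent of
  \<open>z\<close>.\<close>

lemma has_jet_mfps_eval:
  assumes F: "mfps_bounded B \<rho> F"
  shows "has_jet N (\<lambda>z. mfps_eval F z $ a) (F a)"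
proof -
  define r where "r = 1 / (4 * \<rho>)"
  have r: "r > 0" and B: "0 \<le> B" and \<rho>: "\<rho> > 0"
    using F mfps_bounded_nonneg[OF F] unfolding mfps_bounded_def r_def by auto
  define S where "S = (\<Sum>\<^sub>\<infinity>k\<in>(UNIV :: (nat^'b) set). B * (1/4 :: real) ^ mdeg k)"
  have sumS: "(\<lambda>k::nat^'b. B * (1/4 :: real) ^ mdeg k) summable_on X" for X
    by (rule summable_on_subset_banach[where A = UNIV])
      (auto intro!: summable_on_cmult_right summable_on_power_mdeg)
  have bound: "cmod (mfps_eval F z $ a - taylor N (F a) z) \<le> (S / r ^ Suc N) * norm z ^ Suc N"
    if z: "norm z < r" for z
  proof -
    let ?f = "\<lambda>k. mcoeff (F a) k * mmonom z k"
    let ?X = "- {k. mdeg k \<le> N} :: (nat^'b) set"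
    have abs: "(\<lambda>k. norm (?f k)) summable_on UNIV"
      using mfps_bounded_abs_summable[OF F, of z a] z unfolding r_def by simp
    have "(?f has_sum (mfps_eval F z $ a)) UNIV"
      using Infinite_Sum.abs_summable_summable[OF abs] unfolding mfps_eval_def by simp
    moreover have "(?f has_sum taylor N (F a) z) {k. mdeg k \<le> N}"
      unfolding taylor_def by (rule has_sum_finite[OF finite_mdeg_le])
    ultimately have "(?f has_sum (mfps_eval F z $ a - taylor N (F a) z)) (UNIV - {k. mdeg k \<le> N})"
      by (intro has_sum_Diff) auto
    then have eq: "mfps_eval F z $ a - taylor N (F a) z = (\<Sum>\<^sub>\<infinity>k\<in>?X. ?f k)"
      by (simp add: Compl_eq_Diff_UNIV infsumI)
    have absX: "(\<lambda>k. norm (?f k)) summable_on ?X"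
      using abs by (rule summable_on_subset_banach) simp
    have "cmod (\<Sum>\<^sub>\<infinity>k\<in>?X. ?f k) \<le> (\<Sum>\<^sub>\<infinity>k\<in>?X. norm (?f k))" by (rule norm_infsum_bound[OF absX])
    also have "\<dots> \<le> (\<Sum>\<^sub>\<infinity>k\<in>?X. (norm z / r) ^ Suc N * (B * (1/4) ^ mdeg k))"
    proof (rule infsum_mono[OF absX])
      show "(\<lambda>k. (norm z / r) ^ Suc N * (B * (1/4) ^ mdeg k)) summable_on ?X"
        by (intro summable_on_cmult_right sumS)
      fix k :: "nat^'b" assume "k \<in> ?X"
      then have k: "Suc N \<le> mdeg k" by auto
      have "norm (?f k) \<le> (B * \<rho> ^ mdeg k) * norm z ^ mdeg k"
        unfolding norm_mult using F B unfolding mfps_bounded_def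
        by (intro mult_mono norm_mmonom_le) auto
      also have "\<dots> = (norm z / r) ^ mdeg k * (B * (1/4) ^ mdeg k)"
        using \<rho> unfolding r_def by (simp add: power_divide power_mult_distrib field_simps)
      also have "\<dots> \<le> (norm z / r) ^ Suc N * (B * (1/4) ^ mdeg k)"
        using k z r B by (intro mult_right_mono power_decreasing) auto
      finally show "norm (?f k) \<le> (norm z / r) ^ Suc N * (B * (1/4) ^ mdeg k)" .
    qed
    also have "\<dots> = (norm z / r) ^ Suc N * (\<Sum>\<^sub>\<infinity>k\<in>?X. B * (1/4) ^ mdeg k)"
      by (rule infsum_cmult_right) (rule sumS)
    also have "\<dots> \<le> (norm z / r) ^ Suc N * S"
      unfolding S_def using r B by (intro mult_left_mono infsum_mono2 sumS) auto
    finally show ?thesis unfolding eq by (simp add: power_divide mult_ac)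
  qed
  have "\<forall>\<^sub>F z in nhds (0 :: complex^'b). norm z < r"
    using eventually_nhds_in_open[of "ball 0 r" "0 :: complex^'b"] r by simp
  then have "\<forall>\<^sub>F z in nhds 0. cmod (mfps_eval F z $ a - taylor N (F a) z) \<le> (S / r ^ Suc N) * norm z ^ Suc N"
    by eventually_elim (rule bound)
  then show ?thesis unfolding has_jet_def by blast
qed

section \<open>Order of vanishing and jets of compositions\<close>

definition mfps_order_ge :: "nat \<Rightarrow> 'n::finite mfps \<Rightarrow> bool" where
  "mfps_order_ge d C \<longleftrightarrow> (\<forall>k. mdeg k < d \<longrightarrow> mcoeff C k = 0)"

lemma mfps_order_ge_mult:
  fixes C D :: "'n::finite mfps"
  shows "mfps_order_ge d C \<Longrightarrow> mfps_order_ge e D \<Longrightarrow> mfps_order_ge (d + e) (C * D)"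
  unfolding mfps_order_ge_def mcoeff_mult
proof (intro allI impI sum.neutral ballI)
  fix k :: "nat^'n" and p assume *: "\<forall>k. mdeg k < d \<longrightarrow> mcoeff C k = 0" "\<forall>k. mdeg k < e \<longrightarrow> mcoeff D k = 0"
    "mdeg k < d + e" "p \<in> msplits k"
  obtain i j where p: "p = (i, j)" by (cases p)
  have "mdeg i + mdeg j < d + e" using * unfolding p msplits_def by (auto simp: mdeg_add)
  then have "mdeg i < d \<or> mdeg j < e" by linarith
  then show "(case p of (i, j) \<Rightarrow> mcoeff C i * mcoeff D j) = 0" using * p by auto
qed

lemma mfps_order_ge_power: "mfps_order_ge 1 C \<Longrightarrow> mfps_order_ge n (C ^ n)"
proof (induction n)
  case (Suc n)
  then show ?case using mfps_order_ge_mult[of 1 C n "C ^ n"] by simp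
qed (simp add: mfps_order_ge_def)

lemma mfps_order_ge_prod:
  "(\<And>i. i \<in> I \<Longrightarrow> mfps_order_ge (d i) (C i)) \<Longrightarrow> mfps_order_ge (\<Sum>i\<in>I. d i) (\<Prod>i\<in>I. C i)"
  by (induction I rule: infinite_finite_induct) (auto intro: mfps_order_ge_mult simp: mfps_order_ge_def[of 0])

lemma big_power_compose:
  fixes g :: "complex^'n \<Rightarrow> complex^'m"
  assumes f: "big_power N f" and g: "\<forall>\<^sub>F z in nhds 0. norm (g z) \<le> L * norm z"
  shows "big_power N (\<lambda>z. f (g z))"
proof -
  obtain B where B: "\<forall>\<^sub>F w in nhds 0. cmod (f w) \<le> B * norm w ^ N"
    using f unfolding big_power_def by blast
  have "((\<lambda>z :: complex^'n. L * norm z) \<longlongrightarrow> L * norm (0 :: complex^'n)) (at 0)"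
    by (intro tendsto_intros)
  then have "((\<lambda>z. L * norm z) \<longlongrightarrow> 0) (nhds (0 :: complex^'n))"
    using tendsto_at_iff_tendsto_nhds[of "\<lambda>z :: complex^'n. L * norm z" 0] by simp
  then have "(g \<longlongrightarrow> 0) (nhds 0)" by (rule Lim_null_comparison[OF g])
  then have "\<forall>\<^sub>F z in nhds 0. cmod (f (g z)) \<le> B * norm (g z) ^ N"
    using B by (rule eventually_compose_filterlim[rotated])
  with g have "\<forall>\<^sub>F z in nhds 0. cmod (f (g z)) \<le> (\<bar>B\<bar> * \<bar>L\<bar> ^ N) * norm z ^ N"
  proof eventually_elim
    case (elim z)
    have "cmod (f (g z)) \<le> \<bar>B\<bar> * norm (g z) ^ N" using elim(2) by (rule order_trans) (intro mult_right_mono, auto)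
    also have "\<dots> \<le> \<bar>B\<bar> * (\<bar>L\<bar> * norm z) ^ N"
      by (intro mult_left_mono power_mono order_trans[OF elim(1) mult_right_mono[OF abs_ge_self norm_ge_zero]]) auto
    finally show ?case by (simp add: power_mult_distrib mult.assoc)
  qed
  then show ?thesis unfolding big_power_def by blast
qed

text \<open>Since g(z) = O(|z|), replacing \<phi> by its Taylor polynomial changes \<phi>(g(z)) only
  by O(|z|^(N+1)). The jet of the polynomial in g agrees with \<open>mfps_compose C G\<close> up to
  degree N: a product of the \<open>G j\<close> with exponent \<open>l\<close> has order at least
  \<open>mdeg l\<close>, so indices with \<open>mdeg l > mdeg k\<close> contribute nothing at
  \<open>k\<close>.\<close>

lemma has_jet_compose:
  fixes g :: "complex^'n \<Rightarrow> complex^'p::finite"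
  assumes \<phi>: "has_jet N \<phi> C" and G: "\<And>j. has_jet N (\<lambda>z. g z $ j) (G j)" and G0: "\<And>j. mcoeff (G j) 0 = 0"
    and g: "\<forall>\<^sub>F z in nhds 0. norm (g z) \<le> L * norm z"
  shows "has_jet N (\<lambda>z. \<phi> (g z)) (mfps_compose C G)"
proof -
  define D where "D = (\<Sum>l | mdeg l \<le> N. mfps_scale (mcoeff C l) (\<Prod>j\<in>UNIV. G j ^ (l $ j)))"
  have "has_jet N (\<lambda>z. taylor N C (g z)) D"
    unfolding taylor_def D_def mmonom_def by (intro has_jet_sum has_jet_scale has_jet_prod has_jet_power G)
  moreover have "taylor N D z = taylor N (mfps_compose C G) z" for z
    unfolding taylor_def
  proof (intro sum.cong refl)
    fix k :: "nat^'n" assume "k \<in> {k. mdeg k \<le> N}"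
    then have k: "mdeg k \<le> N" by simp
    have ord: "mfps_order_ge (mdeg l) (\<Prod>j\<in>UNIV. G j ^ (l $ j))" for l
      unfolding mdeg_def
    proof (intro mfps_order_ge_prod mfps_order_ge_power)
      fix j
      show "mfps_order_ge 1 (G j)" unfolding mfps_order_ge_def
      proof (intro allI impI)
        fix k :: "nat^'n" assume "mdeg k < 1"
        then have "k = 0" by (simp add: mdeg_def vec_eq_iff)
        then show "mcoeff (G j) k = 0" using G0 by simp
      qed
    qed
    have "mcoeff D k = (\<Sum>l | mdeg l \<le> N. mcoeff C l * mcoeff (\<Prod>j\<in>UNIV. G j ^ (l $ j)) k)"
      unfolding D_def mcoeff_sum by (simp add: mfps_scale_def)
    also have "\<dots> = (\<Sum>l | mdeg l \<le> mdeg k. mcoeff C l * mcoeff (\<Prod>j\<in>UNIV. G j ^ (l $ j)) k)"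
      by (rule sum.mono_neutral_right[OF finite_mdeg_le])
        (use k ord in \<open>auto simp: mfps_order_ge_def not_le\<close>)
    finally show "mcoeff D k * mmonom z k = mcoeff (mfps_compose C G) k * mmonom z k"
      by (simp add: mfps_compose_def)
  qed
  ultimately have "big_power (Suc N) (\<lambda>z. taylor N C (g z) - taylor N (mfps_compose C G) z)"
    unfolding has_jet_iff by simp
  moreover have "big_power (Suc N) (\<lambda>z. \<phi> (g z) - taylor N C (g z))"
    using big_power_compose[OF \<phi>[unfolded has_jet_iff] g] .
  ultimately show ?thesis unfolding has_jet_iff using big_power_add by fastforce
qed

section \<open>Invariant submanifolds\<close>

text \<open>Maximal row rank means independent rows, equivalently a right inverse. As
  \<open>rows A\<close> is a set, injectivity of the row map has to be established in both
  directions: a repeated row would lower the rank, or give a nontrivial relation.\<close>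

lemma rank_eq_card_iff:
  fixes A :: "'a::field^'n^'m"
  shows "rank A = CARD('m) \<longleftrightarrow> (\<exists>B. A ** B = mat 1)"
proof -
  have rows: "rows A = range (\<lambda>i. row i A)" by (auto simp: rows_def)
  then have fin: "finite (rows A)" by simp
  show ?thesis unfolding row_rank_def_gen matrix_right_invertible_independent_rows
  proof
    assume dim: "vec.dim (rows A) = CARD('m)"
    have "card (rows A) \<le> CARD('m)" unfolding rows by (rule card_image_le) simp
    moreover have "vec.dim (rows A) \<le> card (rows A)" by (rule vec.dim_le_card'[OF fin])
    ultimately have card: "card (rows A) = CARD('m)" using dim by simp
    then have inj: "inj (\<lambda>i. row i A)" unfolding rows by (intro eq_card_imp_inj_on) auto
    have ind: "vec.independent (rows A)"
      using vec.card_le_dim_spanning[of "rows A" "rows A"] vec.span_superset fin dim card by auto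
    show "\<forall>c. (\<Sum>i\<in>UNIV. c i *s row i A) = 0 \<longrightarrow> (\<forall>i. c i = 0)"
    proof (intro allI impI)
      fix c i assume c: "(\<Sum>i\<in>UNIV. c i *s row i A) = 0"
      define u where "u v = c (inv (\<lambda>i. row i A) v)" for v
      have u: "u (row i A) = c i" for i unfolding u_def using inv_f_f[OF inj] by simp
      have "(\<Sum>v\<in>rows A. u v *s v) = 0"
        unfolding rows by (subst sum.reindex[OF inj]) (simp add: u c)
      then have "u (row i A) = 0" using ind vec.dependent_finite[OF fin] rows by blast
      then show "c i = 0" by (simp add: u)
    qed
  next
    assume c: "\<forall>c. (\<Sum>i\<in>UNIV. c i *s row i A) = 0 \<longrightarrow> (\<forall>i. c i = 0)"
    have inj: "inj (\<lambda>i. row i A)"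
    proof (rule injI, rule ccontr)
      fix i j assume ij: "row i A = row j A" "i \<noteq> j"
      define d where "d k = (if k = i then 1 else if k = j then -1 else 0 :: 'a)" for k
      have "(\<Sum>k\<in>UNIV. d k *s row k A) = (\<Sum>k\<in>{i, j}. d k *s row k A)"
        by (rule sum.mono_neutral_right) (auto simp: d_def)
      also have "\<dots> = 0" using ij by (simp add: d_def)
      finally have "d i = 0" using c by blast
      then show False by (simp add: d_def)
    qed
    have "vec.independent (rows A)"
      unfolding vec.dependent_finite[OF fin]
    proof
      assume "\<exists>u. (\<exists>v\<in>rows A. u v \<noteq> 0) \<and> (\<Sum>v\<in>rows A. u v *s v) = 0"
      then obtain u v where u: "v \<in> rows A" "u v \<noteq> 0" "(\<Sum>v\<in>rows A. u v *s v) = 0" by blast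
      have "(\<Sum>i\<in>UNIV. u (row i A) *s row i A) = 0"
        using u(3) unfolding rows by (subst (asm) sum.reindex[OF inj]) simp
      then have "u (row i A) = 0" for i using spec[OF c, of "\<lambda>i. u (row i A)"] by blast
      then show False using u unfolding rows by blast
    qed
    then have "vec.dim (rows A) = card (rows A)" by (rule vec.dim_eq_card_independent)
    also have "\<dots> = CARD('m)" unfolding rows by (rule card_image[OF inj])
    finally show "vec.dim (rows A) = CARD('m)" .
  qed
qed

lemma continuous_on_det:
  fixes A :: "'x::topological_space \<Rightarrow> complex^'n^'n"
  assumes "continuous_on S A"
  shows "continuous_on S (\<lambda>x. det (A x))"
  unfolding det_def by (intro continuous_intros assms continuous_on_component)

text \<open>If h is not constant, h(s) = s^n g(s) with g without zeros near 0. Flatness of order n+1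
  gives |g(s)| \<le> B|s|, so g(0) = 0, a contradiction.\<close>

lemma holomorphic_flat_zero:
  fixes h :: "complex \<Rightarrow> complex"
  assumes h: "h holomorphic_on ball 0 R" and R: "0 < R"
    and flat: "\<And>N. \<exists>B. \<forall>\<^sub>F s in nhds 0. cmod (h s) \<le> B * cmod s ^ Suc N"
    and s: "s \<in> ball 0 R"
  shows "h s = 0"
proof -
  have h0: "h 0 = 0" using flat[of 0] eventually_nhds_x_imp_x by fastforce
  have "h constant_on ball 0 R"
  proof (rule ccontr)
    assume nc: "\<not> h constant_on ball 0 R"
    have c: "0 \<in> ball 0 R" using R by simp
    obtain g r n where n: "0 < n" and r: "0 < r" "ball (0 :: complex) r \<subseteq> ball 0 R"
      and g: "g holomorphic_on ball 0 r" "\<And>w. w \<in> ball 0 r \<Longrightarrow> h w = (w - 0) ^ n * g w"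
        "\<And>w. w \<in> ball 0 r \<Longrightarrow> g w \<noteq> 0"
      by (rule holomorphic_factor_zero_nonconstant[OF h open_ball connected_ball c h0 nc]) (rule that)
    obtain B where B: "\<forall>\<^sub>F s in nhds 0. cmod (h s) \<le> B * cmod s ^ Suc n" using flat by blast
    have "\<forall>\<^sub>F s in at 0. cmod (g s) \<le> B * cmod s"
      using eventually_at_ball'[OF r(1), of 0 UNIV] B[unfolded eventually_nhds_conv_at, THEN conjunct1]
    proof eventually_elim
      case (elim s)
      then have "cmod s ^ n * cmod (g s) \<le> cmod s ^ n * (B * cmod s)"
        using g(2)[of s] by (simp add: norm_mult norm_power mult_ac)
      then show ?case using elim(1) by (simp add: mult_le_cancel_left_pos)
    qed
    moreover have "((\<lambda>s. B * cmod s) \<longlongrightarrow> B * cmod 0) (at 0)" by (intro tendsto_intros)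
    ultimately have "(g \<longlongrightarrow> 0) (at 0)" by (intro Lim_null_comparison[of g]) simp_all
    moreover have "isCont g 0"
      using holomorphic_on_imp_continuous_on[OF g(1)] r continuous_on_interior[of "ball 0 r" g 0] by simp
    then have "(g \<longlongrightarrow> g 0) (at 0)" by (simp add: isCont_def)
    ultimately have "g 0 = 0" using tendsto_unique[OF at_neq_bot] by blast
    then show False using g(3)[of 0] r by simp
  qed
  then show ?thesis using h0 s R unfolding constant_on_def by (metis centre_in_ball)
qed

text \<open>\<open>mfps_eval F (g z) $ a\<close> and the combination of the components of
  \<open>mfps_eval F z\<close> with truncated cofactors have the same jet. Their difference is
  therefore O(|z|^(N+1)), and the second one vanishes where F does.\<close>

lemma mfps_expansion_ideal_flat:
  fixes F :: "'p::finite \<Rightarrow> 'n::finite mfps" and g :: "complex^'n \<Rightarrow> complex^'n"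
  assumes F: "mfps_bounded B \<rho> F" and G: "mfps_bounded B' \<rho>' G"
    and gG: "\<forall>\<^sub>F z in nhds 0. g z = mfps_eval G z" and g0: "g 0 = 0"
    and ideal: "mfps_compose (F a) G \<in> mfps_ideal F"
  shows "\<exists>C. \<forall>\<^sub>F z in nhds 0. mfps_eval F z = 0 \<longrightarrow> cmod (mfps_eval F (g z) $ a) \<le> C * norm z ^ Suc N"
proof -
  obtain H where H: "mfps_compose (F a) G = (\<Sum>b\<in>UNIV. H b * F b)"
    using ideal unfolding mfps_ideal_def by blast
  have jet_g: "has_jet N (\<lambda>z. g z $ j) (G j)" for N j
  proof (rule has_jet_cong[OF _ has_jet_mfps_eval[OF G, of N j]])
    show "\<forall>\<^sub>F z in nhds 0. mfps_eval G z $ j = g z $ j" using gG by eventually_elim simp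
  qed
  have G0: "mcoeff (G j) 0 = 0" for j
    using eventually_nhds_x_imp_x[OF gG] g0 mfps_eval_0[of G j] by simp
  have "\<exists>L. \<forall>\<^sub>F z in nhds 0. cmod (g z $ j) \<le> L * norm z" for j
  proof -
    have "taylor 0 (G j) z = 0" for z
      unfolding taylor_def
    proof (intro sum.neutral ballI)
      fix k :: "nat^'n" assume "k \<in> {k. mdeg k \<le> 0}"
      then have "k = 0" by (simp add: mdeg_def vec_eq_iff)
      then show "mcoeff (G j) k * mmonom z k = 0" using G0 by simp
    qed
    then show ?thesis using jet_g[of 0 j] unfolding has_jet_def by simp
  qed
  then obtain L where L: "\<And>j. \<forall>\<^sub>F z in nhds 0. cmod (g z $ j) \<le> L j * norm z" by metis
  have "\<forall>\<^sub>F z in nhds 0. \<forall>j. cmod (g z $ j) \<le> L j * norm z" by (intro eventually_all_finite L)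
  then have g_le: "\<forall>\<^sub>F z in nhds 0. norm (g z) \<le> (\<Sum>j\<in>UNIV. L j) * norm z"
  proof eventually_elim
    case (elim z)
    have "norm (g z) \<le> (\<Sum>j\<in>UNIV. cmod (g z $ j))" unfolding norm_vec_def by (rule L2_set_le_sum) simp
    also have "\<dots> \<le> (\<Sum>j\<in>UNIV. L j * norm z)" using elim by (intro sum_mono) simp
    finally show ?case by (simp add: sum_distrib_right)
  qed
  have "has_jet N (\<lambda>z. mfps_eval F (g z) $ a) (mfps_compose (F a) G)"
    by (rule has_jet_compose[OF has_jet_mfps_eval[OF F] jet_g G0 g_le])
  moreover have "has_jet N (\<lambda>z. \<Sum>b\<in>UNIV. taylor N (H b) z * mfps_eval F z $ b) (mfps_compose (F a) G)"
    unfolding H by (intro has_jet_sum has_jet_mult has_jet_taylor has_jet_mfps_eval[OF F])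
  ultimately have "big_power (Suc N) (\<lambda>z. mfps_eval F (g z) $ a - (\<Sum>b\<in>UNIV. taylor N (H b) z * mfps_eval F z $ b))"
    unfolding has_jet_iff using big_power_diff by fastforce
  then obtain C where "\<forall>\<^sub>F z in nhds 0. cmod (mfps_eval F (g z) $ a -
      (\<Sum>b\<in>UNIV. taylor N (H b) z * mfps_eval F z $ b)) \<le> C * norm z ^ Suc N"
    unfolding big_power_def by blast
  then have "\<forall>\<^sub>F z in nhds 0. mfps_eval F z = 0 \<longrightarrow> cmod (mfps_eval F (g z) $ a) \<le> C * norm z ^ Suc N"
    by eventually_elim (auto simp: vec_eq_iff)
  then show ?thesis by blast
qed

text \<open>
  With a right inverse \<open>P\<close> of \<open>D\<^sub>0 F\<close>, the map \<open>z - P (D\<^sub>0 F z - F z)\<close> straightens \<open>F\<close>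
  to its linear part, without choosing a complement of the kernel.
\<close>
lemma straightening:
  fixes F :: "'p::finite \<Rightarrow> 'n::finite mfps"
  assumes F: "mfps_bounded B \<rho> F" and F0: "\<And>a. mcoeff (F a) 0 = 0"
    and P: "mfps_linear_part F ** P = mat 1"
  obtains U V \<Psi> \<gamma> where "open U" "0 \<in> U" "open V" "0 \<in> V" "homeomorphism U V \<Psi> \<gamma>" "\<Psi> 0 = 0"
    "\<And>z. mfps_eval F z = mfps_linear_part F *v \<Psi> z"
    "\<And>y. y \<in> V \<Longrightarrow> \<exists>M :: complex^'n^'n. (\<gamma> has_derivative (*v) M) (at y)"
proof -
  define L where "L = mfps_linear_part F"
  define S where "S = ball (0 :: complex^'n) (1 / (4 * \<rho>))"
  obtain J where J: "\<And>z. z \<in> S \<Longrightarrow> (mfps_eval F has_derivative (*v) (J z)) (at z)"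
    and contJ: "continuous_on S J" and J0: "J 0 = L"
    using mfps_eval_C1[OF F] unfolding S_def L_def by metis
  define \<Psi> where "\<Psi> z = z - P *v (L *v z - mfps_eval F z)" for z
  define K where "K z = mat 1 - P ** (L - J z)" for z
  have K: "K z *v h = h - P *v (L *v h - J z *v h)" for z h
    unfolding K_def
    by (simp add: matrix_vector_mult_diff_rdistrib matrix_vector_mult_diff_distrib flip: matrix_vector_mul_assoc)
  have blK: "bounded_linear ((*v) (K z))" for z by simp
  have F00: "mfps_eval F 0 = 0" using mfps_eval_0[of F] F0 by (simp add: vec_eq_iff)
  have S: "open S" "0 \<in> S" using F unfolding S_def mfps_bounded_def by auto
  have \<Psi>0: "\<Psi> 0 = 0" unfolding \<Psi>_def by (simp add: F00)
  define f' where "f' z = Blinfun ((*v) (K z))" for z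
  have f': "blinfun_apply (f' z) = (*v) (K z)" for z
    unfolding f'_def by (rule bounded_linear_Blinfun_apply[OF blK])
  have der: "(\<Psi> has_derivative blinfun_apply (f' z)) (at z)" if "z \<in> S" for z
    unfolding f' K[abs_def] \<Psi>_def
    by (intro has_derivative_diff has_derivative_ident J[OF that]
        bounded_linear.has_derivative[OF matrix_vector_mul_bounded_linear])
  have cont: "continuous_on S f'"
  proof (rule continuous_on_blinfun_componentwise)
    fix i :: "complex^'n"
    have "continuous_on S (\<lambda>z. i - P *v (L *v i - J z *v i))"
      unfolding matrix_vector_mult_def[of "J _"]
      by (intro continuous_intros continuous_on_vec_lambda continuous_on_component contJ
          bounded_linear.continuous_on[OF matrix_vector_mul_bounded_linear])
    then show "continuous_on S (\<lambda>z. blinfun_apply (f' z) i)" unfolding f' K .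
  qed
  \<comment> \<open>At 0 the correction \<open>P ** (L - J z)\<close> vanishes, so \<Psi> has the
    identity as derivative there.\<close>
  have id: "id_blinfun o\<^sub>L f' 0 = id_blinfun"
    by (rule blinfun_eqI) (simp add: f' K J0)
  obtain U V \<gamma> g' where U: "open U" "U \<subseteq> S" "0 \<in> U" and V: "open V" "\<Psi> 0 \<in> V" and hom: "homeomorphism U V \<Psi> \<gamma>"
    and d\<gamma>: "\<And>y. y \<in> V \<Longrightarrow> (\<gamma> has_derivative (g' y)) (at y)"
    and g': "\<And>y. y \<in> V \<Longrightarrow> g' y = inv (blinfun_apply (f' (\<gamma> y)))"
    and bij: "\<And>y. y \<in> V \<Longrightarrow> bij (blinfun_apply (f' (\<gamma> y)))"
    by (rule inverse_function_theorem[OF S(1) der cont S(2) id]) (assumption, rule that)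
  \<comment> \<open>The inverse of a complex matrix map is again given by a complex matrix; this is
    what makes \<gamma> holomorphic and not merely real differentiable.\<close>
  have "\<exists>M :: complex^'n^'n. (\<gamma> has_derivative (*v) M) (at y)" if y: "y \<in> V" for y
  proof -
    have "inj ((*v) (K (\<gamma> y)))" using bij[OF y] unfolding f' by (rule bij_is_inj)
    then obtain M where M: "M ** K (\<gamma> y) = mat 1" using matrix_left_invertible_injective by blast
    have "inv ((*v) (K (\<gamma> y))) = (*v) M"
    proof
      fix x
      obtain u where u: "x = K (\<gamma> y) *v u" using bij[OF y] unfolding f' by (metis bij_pointE)
      show "inv ((*v) (K (\<gamma> y))) x = M *v x"
        unfolding u using inv_f_f[OF \<open>inj ((*v) (K (\<gamma> y)))\<close>] by (simp add: matrix_vector_mul_assoc M)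
    qed
    then show ?thesis using d\<gamma>[OF y] g'[OF y] unfolding f' by auto
  qed
  moreover have "mfps_eval F z = L *v \<Psi> z" for z
  proof -
    have "L *v (P *v w) = w" for w by (simp add: matrix_vector_mul_assoc P[folded L_def])
    then show ?thesis unfolding \<Psi>_def by (simp add: matrix_vector_mult_diff_distrib)
  qed
  ultimately show thesis using that[OF U(1,3) V(1) _ hom \<Psi>0] V(2) \<Psi>0 unfolding L_def by simp
qed

text \<open>Along the curve, the component of F after g is a holomorphic function of one variable,
  flat at 0, hence zero on the disc. Radius 2 puts the parameter 1 in the interior.\<close>

lemma mfps_eval_flat_curve:
  fixes F :: "'p::finite \<Rightarrow> 'n::finite mfps" and g c :: "_ \<Rightarrow> complex^'n"
  assumes F: "mfps_bounded B \<rho> F" and G: "mfps_bounded B' \<rho>' G"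
    and W: "open W" "0 \<in> W" "\<And>z. z \<in> W \<Longrightarrow> g z = mfps_eval G z"
      "\<And>z. z \<in> W \<Longrightarrow> norm z < 1 / (4 * \<rho>')" "\<And>z. z \<in> W \<Longrightarrow> norm (g z) < 1 / (4 * \<rho>)"
    and c: "\<And>s. s \<in> ball 0 2 \<Longrightarrow> c s \<in> W"
      "\<And>s. s \<in> ball 0 2 \<Longrightarrow> \<exists>b. (c has_derivative (\<lambda>u. u *s b)) (at s)"
      "c 0 = 0"
    and zero: "\<And>s. s \<in> ball 0 2 \<Longrightarrow> mfps_eval F (c s) = 0"
    and flat: "\<And>N. \<exists>C. \<forall>\<^sub>F z in nhds 0. mfps_eval F z = 0 \<longrightarrow> cmod (mfps_eval F (g z) $ a) \<le> C * norm z ^ Suc N"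
  shows "mfps_eval F (g (c 1)) $ a = 0"
proof -
  obtain JF where JF: "\<And>z. z \<in> ball 0 (1 / (4 * \<rho>)) \<Longrightarrow> (mfps_eval F has_derivative (*v) (JF z)) (at z)"
    using mfps_eval_C1[OF F] by metis
  obtain JG where JG: "\<And>z. z \<in> ball 0 (1 / (4 * \<rho>')) \<Longrightarrow> (mfps_eval G has_derivative (*v) (JG z)) (at z)"
    using mfps_eval_C1[OF G] by metis
  have dg: "(g has_derivative (*v) (JG z)) (at z)" if z: "z \<in> W" for z
    by (rule has_derivative_transform_within_open[OF _ W(1) z W(3)[symmetric]])
      (use JG[of z] W(4)[OF z] in simp_all)
  define h where "h s = mfps_eval F (g (c s)) $ a" for s
  have "h field_differentiable (at s)" if s: "s \<in> ball 0 2" for s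
  proof -
    obtain b where b: "(c has_derivative (\<lambda>u. u *s b)) (at s)" using c(2)[OF s] by blast
    have "((\<lambda>s. mfps_eval F (g (c s))) has_derivative (\<lambda>u. JF (g (c s)) *v (JG (c s) *v (u *s b)))) (at s)"
      by (rule has_derivative_compose[OF has_derivative_compose[OF b dg[OF c(1)[OF s]]] JF])
        (use W(5)[OF c(1)[OF s]] in simp)
    then have "(h has_derivative (\<lambda>u. (JF (g (c s)) *v (JG (c s) *v (u *s b))) $ a)) (at s)"
      unfolding h_def by (rule bounded_linear.has_derivative[OF bounded_linear_vec_nth])
    moreover have "(\<lambda>u. (JF (g (c s)) *v (JG (c s) *v (u *s b))) $ a) = (*) ((JF (g (c s)) *v (JG (c s) *v b)) $ a)"
      by (simp add: fun_eq_iff vec.scale mult.commute)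
    ultimately have "(h has_field_derivative (JF (g (c s)) *v (JG (c s) *v b)) $ a) (at s)"
      unfolding has_field_derivative_def by simp
    then show ?thesis unfolding field_differentiable_def by blast
  qed
  then have hol: "h holomorphic_on ball 0 2"
    unfolding holomorphic_on_def using field_differentiable_at_within by blast
  obtain b where b: "(c has_derivative (\<lambda>u. u *s b)) (at 0)" using c(2)[of 0] by auto
  \<comment> \<open>Differentiability at 0 bounds |c(s)| by a multiple of |s|, which turns flatness
    in \<open>z\<close> into flatness in \<open>s\<close>.\<close>
  have c_le: "\<forall>\<^sub>F s in nhds 0. norm (c s) \<le> (norm b + 1) * cmod s"
  proof -
    obtain d where d: "d > 0" "\<And>s. norm (s - 0) < d \<Longrightarrow> norm (c s - c 0 - (s - 0) *s b) \<le> 1 * norm (s - 0)"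
      using b unfolding has_derivative_at_alt by (meson zero_less_one)
    have "\<forall>\<^sub>F s :: complex in nhds 0. s \<in> ball 0 d"
      using d by (intro eventually_nhds_in_open) auto
    then show ?thesis
    proof eventually_elim
      case (elim s)
      have "norm (s *s b) = cmod s * norm b"
        by (simp add: norm_vec_def norm_mult L2_set_right_distrib)
      moreover have "norm (c s - s *s b) \<le> cmod s" using d(2)[of s] elim c(3) by simp
      moreover have "norm (c s) \<le> norm (c s - s *s b) + norm (s *s b)"
        using norm_triangle_ineq[of "c s - s *s b" "s *s b"] by simp
      ultimately show ?case by (simp add: algebra_simps)
    qed
  qed
  have "\<exists>C. \<forall>\<^sub>F s in nhds 0. cmod (h s) \<le> C * cmod s ^ Suc N" for N
  proof -
    obtain C where C: "\<forall>\<^sub>F z in nhds 0. mfps_eval F z = 0 \<longrightarrow> cmod (mfps_eval F (g z) $ a) \<le> C * norm z ^ Suc N"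
      using flat by blast
    have "isCont c 0" using b has_derivative_continuous by blast
    then have "filterlim c (nhds 0) (nhds 0)"
      using c(3) unfolding isCont_def tendsto_at_iff_tendsto_nhds by simp
    then have "\<forall>\<^sub>F s in nhds 0. mfps_eval F (c s) = 0 \<longrightarrow> cmod (h s) \<le> C * norm (c s) ^ Suc N"
      unfolding h_def using C by (rule eventually_compose_filterlim[rotated])
    moreover have "\<forall>\<^sub>F s :: complex in nhds 0. s \<in> ball 0 2" by (intro eventually_nhds_in_open) auto
    ultimately have "\<forall>\<^sub>F s in nhds 0. cmod (h s) \<le> (\<bar>C\<bar> * (norm b + 1) ^ Suc N) * cmod s ^ Suc N"
      using c_le
    proof eventually_elim
      case (elim s)
      then have "cmod (h s) \<le> C * norm (c s) ^ Suc N" using zero by blast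
      also have "\<dots> \<le> \<bar>C\<bar> * norm (c s) ^ Suc N" by (rule mult_right_mono) auto
      also have "\<dots> \<le> \<bar>C\<bar> * ((norm b + 1) * cmod s) ^ Suc N"
        using elim(3) by (intro mult_left_mono power_mono) auto
      finally show ?case by (simp only: power_mult_distrib mult.assoc)
    qed
    then show ?thesis by blast
  qed
  then have "h 1 = 0" by (intro holomorphic_flat_zero[OF hol]) auto
  then show ?thesis unfolding h_def .
qed

lemma invariant_submanifoldI:
  fixes F :: "'p::finite \<Rightarrow> 'n::finite mfps" and g :: "complex^'n \<Rightarrow> complex^'n"
  assumes conv: "mfps_converges F" and inv: "formal_invariant_submanifold g F" and g0: "g 0 = 0"
  shows "defines_invariant_submanifold g F"
proof -
  define L where "L = mfps_linear_part F"
  have F0: "mcoeff (F a) 0 = 0" for a using inv unfolding formal_invariant_submanifold_def by blast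
  obtain P where P: "L ** P = mat 1"
    using inv unfolding formal_invariant_submanifold_def rank_eq_card_iff L_def by blast
  obtain G where G: "has_mfps_expansion g G" and ideal: "\<And>a. mfps_compose (F a) G \<in> mfps_ideal F"
    using inv unfolding formal_invariant_submanifold_def by blast
  have gG: "\<forall>\<^sub>F z in nhds 0. g z = mfps_eval G z \<and> mfps_summable_at G z"
    using G unfolding has_mfps_expansion_def
  proof eventually_elim
    case (elim z)
    have "mfps_eval G z $ a = g z $ a" for a
      unfolding mfps_eval_def vec_lambda_beta by (rule infsumI) (rule spec[OF elim])
    then show ?case using elim unfolding mfps_summable_at_def summable_on_def vec_eq_iff by auto
  qed
  then have "mfps_converges G" unfolding eventually_nhds mfps_converges_def by blast
  then obtain B' \<rho>' where Gb: "mfps_bounded B' \<rho>' G" by (rule mfps_converges_bounded)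
  obtain B \<rho> where Fb: "mfps_bounded B \<rho> F" using conv by (rule mfps_converges_bounded)
  define S where "S = ball (0 :: complex^'n) (1 / (4 * \<rho>))"
  have S: "open S" "0 \<in> S" using Fb unfolding S_def mfps_bounded_def by auto
  obtain J where J: "\<And>z. z \<in> S \<Longrightarrow> (mfps_eval F has_derivative (*v) (J z)) (at z)"
    and contJ: "continuous_on S J" and J0: "J 0 = L"
    using mfps_eval_C1[OF Fb] unfolding S_def L_def by metis
  have F00: "mfps_eval F 0 = 0" using mfps_eval_0[of F] F0 by (simp add: vec_eq_iff)
  have gG': "\<forall>\<^sub>F z in nhds 0. g z = mfps_eval G z" using gG by eventually_elim simp
  have g_tendsto: "filterlim g (nhds 0) (nhds 0)"
  proof -
    have "mfps_eval G 0 = 0" using eventually_nhds_x_imp_x[OF gG'] g0 by simp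
    moreover have "isCont (mfps_eval G) 0"
    proof -
      obtain JG where "\<And>z. z \<in> ball 0 (1 / (4 * \<rho>')) \<Longrightarrow> (mfps_eval G has_derivative (*v) (JG z)) (at z)"
        using mfps_eval_C1[OF Gb] by metis
      moreover have "0 \<in> ball (0 :: complex^'n) (1 / (4 * \<rho>'))" using Gb by (simp add: mfps_bounded_def)
      ultimately show ?thesis using has_derivative_continuous by blast
    qed
    ultimately have "filterlim (mfps_eval G) (nhds 0) (nhds 0)"
      unfolding isCont_def tendsto_at_iff_tendsto_nhds by simp
    then show ?thesis by (rule filterlim_cong[OF refl refl gG', THEN iffD2])
  qed
  \<comment> \<open>With \<open>P\<close> fixed, invertibility of \<open>J z ** P\<close> is an open
    condition, true at 0. It gives \<open>J z\<close> a right inverse, hence full rank on all of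
    \<open>U\<close>.\<close>
  define U where "U = {z \<in> S. det (J z ** P) \<noteq> 0}"
  have "continuous_on S (\<lambda>z. J z ** P)"
    unfolding matrix_matrix_mult_def
    by (intro continuous_on_vec_lambda continuous_intros continuous_on_component contJ)
  then have "open (S \<inter> (\<lambda>z. det (J z ** P)) -` (- {0}))"
    by (intro continuous_open_preimage continuous_on_det S) auto
  moreover have "S \<inter> (\<lambda>z. det (J z ** P)) -` (- {0}) = U" unfolding U_def by auto
  ultimately have U: "open U" by simp
  have U0: "0 \<in> U" unfolding U_def using S by (simp add: J0 P)
  have sub: "submanifold_equation (mfps_eval F) U"
    unfolding submanifold_equation_def cholomorphic_on_def
  proof (intro conjI ballI impI)
    fix z assume z: "z \<in> U"
    then have d: "(mfps_eval F has_derivative (*v) (J z)) (at z)" using J unfolding U_def by simp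
    then show "\<exists>J. (mfps_eval F has_derivative (*v) J) (at z)" by blast
    have "invertible (J z ** P)" using z unfolding U_def invertible_det_nz by simp
    then obtain Q where "J z ** P ** Q = mat 1" unfolding invertible_def by blast
    then have "J z ** (P ** Q) = mat 1" by (simp add: matrix_mul_assoc)
    then have "rank (J z) = CARD('p)" unfolding rank_eq_card_iff by blast
    with d show "\<exists>J. (mfps_eval F has_derivative (*v) J) (at z) \<and> rank J = CARD('p)" by blast
  qed (rule U)
  obtain X V \<Psi> \<gamma> where X: "open X" "0 \<in> X" and V: "open V" "0 \<in> V" and hom: "homeomorphism X V \<Psi> \<gamma>"
    and \<Psi>0: "\<Psi> 0 = 0" and F\<Psi>: "\<And>z. mfps_eval F z = L *v \<Psi> z"
    and \<gamma>: "\<And>y. y \<in> V \<Longrightarrow> \<exists>M :: complex^'n^'n. (\<gamma> has_derivative (*v) M) (at y)"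
    using straightening[OF Fb F0 P[unfolded L_def]] unfolding L_def by metis
  have \<gamma>0: "\<gamma> 0 = 0" using hom X \<Psi>0 unfolding homeomorphism_def by metis
  have "\<forall>\<^sub>F z in nhds 0. g z = mfps_eval G z \<and> norm z < 1 / (4 * \<rho>') \<and> norm (g z) < 1 / (4 * \<rho>)"
  proof (intro eventually_conj gG')
    show "\<forall>\<^sub>F z :: complex^'n in nhds 0. norm z < 1 / (4 * \<rho>')"
      using eventually_nhds_in_open[of "ball 0 (1 / (4 * \<rho>'))" "0 :: complex^'n"] Gb
      by (simp add: mfps_bounded_def)
    have "\<forall>\<^sub>F z in nhds 0. g z \<in> S"
      using filterlim_iff[THEN iffD1, OF g_tendsto] eventually_nhds_in_open[OF S] by blast
    then show "\<forall>\<^sub>F z in nhds 0. norm (g z) < 1 / (4 * \<rho>)" unfolding S_def by simp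
  qed
  then obtain W where W: "open W" "0 \<in> W"
    "\<And>z. z \<in> W \<Longrightarrow> g z = mfps_eval G z" "\<And>z. z \<in> W \<Longrightarrow> norm z < 1 / (4 * \<rho>')"
    "\<And>z. z \<in> W \<Longrightarrow> norm (g z) < 1 / (4 * \<rho>)"
    unfolding eventually_nhds by blast
  have cont\<gamma>: "continuous_on V \<gamma>" using hom unfolding homeomorphism_def by blast
  have "open (V \<inter> \<gamma> -` W)" by (rule continuous_open_preimage[OF cont\<gamma> V(1) W(1)])
  moreover have "0 \<in> V \<inter> \<gamma> -` W" using V W \<gamma>0 by simp
  ultimately obtain e where e: "e > 0" "ball 0 e \<subseteq> V \<inter> \<gamma> -` W" by (meson openE)
  \<comment> \<open>The line through 0 and \<open>\<Psi> z\<close> lies in the kernel of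
    \<open>L\<close>, so \<gamma> maps its part near 0 into the zero set of F and sends the
    parameter 1 to \<open>z\<close>. The bound e/2 keeps all parameters of modulus below 2 inside
    the domain of \<gamma>.\<close>
  have key: "mfps_eval F (g z) = 0" if z: "z \<in> X" "norm (\<Psi> z) < e / 2" "mfps_eval F z = 0" for z
  proof -
    define v where "v = \<Psi> z"
    have nv: "norm (s *s v) = cmod s * norm v" for s
      by (simp add: norm_vec_def norm_mult L2_set_right_distrib)
    have sv: "s *s v \<in> V \<inter> \<gamma> -` W" if "s \<in> ball 0 2" for s
    proof -
      have "norm (s *s v) \<le> 2 * norm v" unfolding nv using that by (intro mult_right_mono) auto
      also have "\<dots> < e" using z(2) by (simp add: v_def)
      finally show ?thesis using e by auto
    qed
    have "mfps_eval F (g (\<gamma> (1 *s v))) $ a = 0" for a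
    proof (rule mfps_eval_flat_curve[OF Fb Gb W, where c = "\<lambda>s. \<gamma> (s *s v)"])
      fix s :: complex assume s: "s \<in> ball 0 2"
      show "\<gamma> (s *s v) \<in> W" using sv[OF s] by simp
      obtain M :: "complex^'n^'n" where M: "(\<gamma> has_derivative (*v) M) (at (s *s v))" using \<gamma> sv[OF s] by blast
      have "bounded_linear (\<lambda>u. u *s v)"
        by (rule bounded_linear_intro[where K = "norm v"])
          (simp_all add: nv vec_eq_iff algebra_simps)
      then have "((\<lambda>u. u *s v) has_derivative (\<lambda>u. u *s v)) (at s)" by (rule bounded_linear_imp_has_derivative)
      from has_derivative_compose[OF this M]
      have "((\<lambda>u. \<gamma> (u *s v)) has_derivative (\<lambda>u. u *s (M *v v))) (at s)" by (simp add: vec.scale)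
      then show "\<exists>b. ((\<lambda>u. \<gamma> (u *s v)) has_derivative (\<lambda>u. u *s b)) (at s)" by blast
      have "\<Psi> (\<gamma> (s *s v)) = s *s v" using hom sv[OF s] unfolding homeomorphism_def by blast
      then have "mfps_eval F (\<gamma> (s *s v)) = s *s (L *v v)" unfolding F\<Psi> by (simp add: vec.scale)
      also have "L *v v = 0" using z(3) unfolding F\<Psi> v_def .
      finally show "mfps_eval F (\<gamma> (s *s v)) = 0" by simp
    next
      show "\<gamma> (0 *s v) = 0" by (simp add: \<gamma>0)
      show "\<exists>C. \<forall>\<^sub>F z in nhds 0. mfps_eval F z = 0 \<longrightarrow> cmod (mfps_eval F (g z) $ a) \<le> C * norm z ^ Suc N" for N
        by (rule mfps_expansion_ideal_flat[OF Fb Gb gG' g0 ideal])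
    qed
    moreover have "\<gamma> v = z" using hom z(1) unfolding homeomorphism_def v_def by blast
    ultimately show ?thesis by (simp add: vec_eq_iff)
  qed
  have "\<forall>\<^sub>F z in nhds 0. z \<in> X \<and> norm (\<Psi> z) < e / 2 \<and> g z \<in> U"
  proof (intro eventually_conj)
    show "\<forall>\<^sub>F z in nhds 0. z \<in> X" using X by (rule eventually_nhds_in_open)
    have "continuous_on X \<Psi>" using hom unfolding homeomorphism_def by blast
    then have "isCont \<Psi> 0" using X continuous_on_eq_continuous_at by blast
    then have "filterlim \<Psi> (nhds 0) (nhds 0)"
      using \<Psi>0 unfolding isCont_def tendsto_at_iff_tendsto_nhds by simp
    moreover have "\<forall>\<^sub>F y :: complex^'n in nhds 0. norm y < e / 2"
      using eventually_nhds_in_open[of "ball 0 (e / 2)" "0 :: complex^'n"] e by simp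
    ultimately show "\<forall>\<^sub>F z in nhds 0. norm (\<Psi> z) < e / 2" unfolding filterlim_iff by blast
    show "\<forall>\<^sub>F z in nhds 0. g z \<in> U"
      using filterlim_iff[THEN iffD1, OF g_tendsto] eventually_nhds_in_open[OF U U0] by blast
  qed
  then have "\<forall>\<^sub>F z in nhds 0. z \<in> {z \<in> U. mfps_eval F z = 0} \<longrightarrow> g z \<in> {z \<in> U. mfps_eval F z = 0}"
    by eventually_elim (use key in blast)
  moreover have "\<forall>z\<in>U. mfps_summable_at F z"
    using mfps_bounded_summable_at[OF Fb] unfolding U_def S_def by auto
  ultimately show ?thesis
    unfolding defines_invariant_submanifold_def using U0 sub F00 by blast
qed

section \<open>The dichotomy\<close>

theorem theorem3:
  fixes m d :: nat
    and f :: "(nat \<Rightarrow> nat) \<Rightarrow> complex^'n \<Rightarrow> complex^'n"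
    and A :: "complex^'n^'n"
    and ev :: "'n \<Rightarrow> complex"
    and ft :: "(nat \<Rightarrow> complex) \<Rightarrow> complex^'n \<Rightarrow> complex^'n"
    and F :: "(nat \<Rightarrow> complex) \<Rightarrow> 'p::finite \<Rightarrow> 'n mfps"
    and C0 C1 :: real
  assumes m: "m \<ge> 1"
    and p: "CARD('p) \<le> CARD('n)"
    and f_holo: "\<And>i. i \<in> mindices m \<Longrightarrow> (\<Sum>j<m. i j) \<le> d \<Longrightarrow> holomorphic_germ0 (f i)"
    and f_O2: "\<And>i. i \<in> mindices m \<Longrightarrow> (\<Sum>j<m. i j) \<le> d \<Longrightarrow>
                 (\<lambda>z. norm (f i z)) \<in> O[nhds 0](\<lambda>z. (norm z)\<^sup>2)"
    and A: "invertible A"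
    and ev: "eigenvalues_with_mult A ev"
    and nonres: "nonresonant ev"
    and ft: "\<And>t z. t \<in> cspace m \<Longrightarrow>
               ft t z = A *v z + (\<Sum>i | i \<in> mindices m \<and> (\<Sum>j<m. i j) \<le> d. tpow m t i *s f i z)"
    and F_inv: "\<And>t. t \<in> cspace m \<Longrightarrow> formal_invariant_submanifold (ft t) (F t)"
    and C0: "C0 > 0" and C1: "C1 > 0"
    and F_poly: "\<And>a k. polynomial_of_degree_less m (C0 + C1 * real (mdeg k)) (\<lambda>t. mcoeff (F t a) k)"
  shows "(\<forall>t\<in>cspace m. mfps_converges (F t) \<and> defines_invariant_submanifold (ft t) (F t)) \<or>
         (\<exists>E \<subseteq> cspace m. Gamma_capacity m E = 0 \<and> (\<forall>t\<in>cspace m - E. \<not> mfps_converges (F t)))"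
proof -
  define E where "E = {t \<in> cspace m. mfps_converges (F t)}"
  show ?thesis
  proof (cases "Gamma_capacity m E = 0")
    case True
    then show ?thesis by (intro disjI2 exI[of _ E]) (auto simp: E_def)
  next
    case False
    then have "0 < Gamma_capacity m E" by (rule iffD2[OF zero_less_iff_neq_zero])
    then obtain U where U: "U \<in> unitary_matrices m"
      and cap: "0 < log_capacity (Gamma1 m (apply_matrix m U ` E))"
      unfolding Gamma_capacity_def less_SUP_iff by blast
    define D where "D N = {t \<in> cspace m. \<forall>j<m. cmod (t j) \<le> real N}" for N :: nat
    \<comment> \<open>A single integer serves as bound for the parameter, as \<open>B\<close> and as
      \<rho>, which makes the family countable. The preimages are taken inside \<open>D N\<close>
      because the coefficients are known to be continuous only on \<open>cspace m\<close>.\<close>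
    define K where "K N = D N \<inter> (\<Inter>a. \<Inter>k. D N \<inter> (\<lambda>t. mcoeff (F t a) k) -` cball 0 (real N * real N ^ mdeg k))"
      for N :: nat
    have cD: "compact (D N)" for N unfolding D_def by (rule compact_polydisc)
    have cK: "compact (K N)" for N
      unfolding K_def
    proof (intro compact_Int_closed[OF cD] closed_INT ballI)
      fix a k
      have "continuous_on (D N) (\<lambda>t. mcoeff (F t a) k)"
        by (rule continuous_on_subset[OF continuous_on_polynomial_of_degree_less[OF F_poly]]) (auto simp: D_def)
      then show "closed (D N \<inter> (\<lambda>t. mcoeff (F t a) k) -` cball 0 (real N * real N ^ mdeg k))"
        by (rule continuous_closed_preimage) (auto intro: compact_imp_closed cD)
    qed
    have EK: "E \<subseteq> (\<Union>N. K N)"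
    proof
      fix t assume "t \<in> E"
      then have t: "t \<in> cspace m" and conv: "mfps_converges (F t)" by (auto simp: E_def)
      obtain B \<rho> where b: "mfps_bounded B \<rho> (F t)" using conv by (rule mfps_converges_bounded)
      obtain N :: nat where N: "max B (max \<rho> (\<Sum>j<m. cmod (t j))) \<le> real N" using real_arch_simple by blast
      have "cmod (t j) \<le> real N" if "j < m" for j
      proof -
        have "cmod (t j) \<le> (\<Sum>j<m. cmod (t j))" using that by (intro member_le_sum) auto
        then show ?thesis using N by simp
      qed
      moreover have "cmod (mcoeff (F t a) k) \<le> real N * real N ^ mdeg k" for a k
      proof -
        have "cmod (mcoeff (F t a) k) \<le> B * \<rho> ^ mdeg k" and "0 < \<rho>" using b unfolding mfps_bounded_def by auto
        then show ?thesis using N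
          by (elim order_trans) (intro mult_mono power_mono, auto)
      qed
      ultimately have "t \<in> K N" unfolding K_def D_def using t by auto
      then show "t \<in> (\<Union>N. K N)" by blast
    qed
    have "\<exists>K'\<in>range (\<lambda>N. apply_matrix m U ` K N). bernstein_walsh m K'"
    proof (rule bernstein_walsh_of_Gamma1[OF cap])
      show "apply_matrix m U ` E \<subseteq> \<Union> (range (\<lambda>N. apply_matrix m U ` K N))" using EK by blast
      show "compact K' \<and> K' \<subseteq> cspace m" if "K' \<in> range (\<lambda>N. apply_matrix m U ` K N)" for K'
        using that apply_matrix_cspace
        by (auto intro!: compact_continuous_image[OF continuous_on_apply_matrix cK])
    qed simp
    then obtain N where bw: "bernstein_walsh m (apply_matrix m U ` K N)" by blast
    \<comment> \<open>Integer upper bounds for \<open>C0\<close> and \<open>C1\<close>: the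
      coefficient of index \<open>k\<close> has degree at most \<open>n0 + n1 * mdeg k\<close>, so
      \<open>C ^ D\<close> is geometric in \<open>mdeg k\<close>.\<close>
    define n0 n1 where "n0 = nat \<lceil>C0\<rceil>" and "n1 = nat \<lceil>C1\<rceil>"
    have "mfps_converges (F t) \<and> defines_invariant_submanifold (ft t) (F t)" if t: "t \<in> cspace m" for t
    proof -
      \<comment> \<open>The inequality lives in the rotated coordinates; composing the coefficients
        with \<open>V\<close> brings them there.\<close>
      define V where "V = apply_matrix m (adjoint_matrix U)"
      have V: "V (apply_matrix m U s) = s" if "s \<in> cspace m" for s
        unfolding V_def by (rule apply_adjoint_matrix[OF U that])
      obtain C where C: "C \<ge> 1" "\<And>D M P. separately_poly m D P \<Longrightarrow>
          (\<forall>s\<in>apply_matrix m U ` K N. cmod (P s) \<le> M) \<Longrightarrow> cmod (P (apply_matrix m U t)) \<le> C ^ D * M"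
        using bspec[OF bw[unfolded bernstein_walsh_def] apply_matrix_cspace[of m U t]] by blast
      have "cmod (mcoeff (F t a) k) \<le> (C ^ n0 * real N) * (C ^ n1 * (real N + 1)) ^ mdeg k" for a k
      proof -
        have "C1 * real (mdeg k) \<le> real n1 * real (mdeg k)"
          unfolding n1_def by (intro mult_right_mono real_nat_ceiling_ge) simp
        then have "C0 + C1 * real (mdeg k) \<le> real (n0 + n1 * mdeg k)"
          using real_nat_ceiling_ge[of C0] unfolding n0_def by simp
        then have "separately_poly m (n0 + n1 * mdeg k) (\<lambda>s. mcoeff (F (V s) a) k)"
          unfolding V_def using polynomial_of_degree_less_separately_poly[OF F_poly] by blast
        moreover have "\<forall>s\<in>apply_matrix m U ` K N. cmod (mcoeff (F (V s) a) k) \<le> real N * real N ^ mdeg k"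
        proof
          fix s assume "s \<in> apply_matrix m U ` K N"
          then obtain u where u: "u \<in> K N" "s = apply_matrix m U u" by blast
          then have "V s = u" using V unfolding K_def D_def by auto
          then show "cmod (mcoeff (F (V s) a) k) \<le> real N * real N ^ mdeg k"
            using u(1) unfolding K_def by auto
        qed
        ultimately have "cmod (mcoeff (F t a) k) \<le> C ^ (n0 + n1 * mdeg k) * (real N * real N ^ mdeg k)"
          using C(2) V[OF t] by fastforce
        \<comment> \<open>Passing to \<open>real N + 1\<close> keeps the geometric ratio positive
          when \<open>N = 0\<close>.\<close>
        also have "\<dots> \<le> C ^ (n0 + n1 * mdeg k) * (real N * (real N + 1) ^ mdeg k)"
          using C(1) by (intro mult_left_mono power_mono) auto
        also have "\<dots> = (C ^ n0 * real N) * (C ^ n1 * (real N + 1)) ^ mdeg k"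
          by (simp add: power_add power_mult power_mult_distrib)
        finally show ?thesis .
      qed
      then have "mfps_bounded (C ^ n0 * real N) (C ^ n1 * (real N + 1)) (F t)"
        unfolding mfps_bounded_def using C(1) by (auto intro!: mult_pos_pos zero_less_power)
      then have conv: "mfps_converges (F t)" by (rule mfps_bounded_converges)
      \<comment> \<open>The filter \<open>nhds 0\<close> includes the point 0 itself, so the O(z^2)
        bound can be read off there.\<close>
      have "f i 0 = 0" if im: "i \<in> mindices m" "(\<Sum>j<m. i j) \<le> d" for i
      proof -
        obtain c where "\<forall>\<^sub>F z in nhds 0. norm (norm (f i z)) \<le> c * norm ((norm z)\<^sup>2)"
          using f_O2[OF im] unfolding bigo_def by blast
        from eventually_nhds_x_imp_x[OF this] show ?thesis by simp
      qed
      then have "ft t 0 = 0" by (simp add: ft[OF t])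
      then show ?thesis using conv invariant_submanifoldI[OF conv F_inv[OF t]] by simp
    qed
    then show ?thesis by blast
  qed
qed

end
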